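(* For $0<q\leq 1$ put $$\alpha_q=\frac{1}{4(2-q)} .$$ For each $0<q\leq 1$ there exists a constant $C_q>0$ such that, as $N\to\infty$, $$\|f\|_q\leq (1+o(1))\,C_q\,(\log N)^{\alpha_q}(\log\log N)^{\frac12-\alpha_q}.$$ In particular, $$\|f\|_1\ll (\log N)^{1/4}(\log\log N)^{1/4}.$$
   Context: For a Dirichlet polynomial $F(s)=\sum_{n\leq N}a(n)n^{-s}$ and $0<q<\infty$, the quantity $\|F\|_q$ is defined by $$\|F\|_q^q=\lim_{T\to\infty}\frac1T\int_0^T|F(it)|^q\,dt .$$ Here $f=f_N$ denotes the Dirichlet polynomial $$f(s)=\sum_{n\leq N}\frac{1}{n^{1/2+s}} .$$ *)

theory Defs
  imports "HOL-Analysis.Analysis" "HOL-Library.Landau_Symbols"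
begin

(* For a Dirichlet polynomial F and q > 0 the limit exists, because t \<mapsto> |F(it)|^q is
   uniformly almost periodic; so Lim denotes the actual mean value. *)
definition dirichlet_norm :: "real \<Rightarrow> (complex \<Rightarrow> complex) \<Rightarrow> real" where
  "dirichlet_norm q F =
     (Lim at_top (\<lambda>T::real. 1 / T * integral {0..T} (\<lambda>t. cmod (F (\<i> * of_real t)) powr q)))
       powr (1 / q)"

definition zeta_half_poly :: "nat \<Rightarrow> complex \<Rightarrow> complex" where
  "zeta_half_poly N s = (\<Sum>n=1..N. 1 / of_nat n powr (1 / 2 + s))"

definition norm_exponent :: "real \<Rightarrow> real" where
  "norm_exponent q = 1 / (4 * (2 - q))"

end

theory Submission
  imports Defs "HOL-Number_Theory.Prime_Powers" "HOL-Real_Asymp.Real_Asymp"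
begin

text \<open>Write $f_S$ for the part of $f$ supported on $S \subseteq \{1,\dots,N\}$, and weight it with
  $H(t) = \prod_{p \le z} (1 - \frac12 p^{-1/2-it})$, which imitates $\zeta^{-1/2}$. Hoelder's inequality bounds the
  mean of $|f_S|^q$ by the mean of $|f_S H|^2$ to the power $q/2$ times the mean of $|H|^{-2q/(2-q)}$ to the
  power $1 - q/2$. The coefficients of $f_S H$ up to $N$ are $n^{-1/2} 2^{-\omega_z(n)}$, where $\omega_z$ counts primes
  up to $z$. If $S$ consists of all $n \le N$ whose $z$-rough part lies in a set $M$ of numbers
  $m \le N / z^{25 \log\log N}$, then Rankin's trick makes the coefficients beyond $N$ negligible, and the mean of
  $|f_S|^q$ is at most a constant times $\bigl(W^{1/2} (\log z)^{\alpha_q}\bigr)^q$ with $W = \sum_{m \in M} 1/m$.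

  Apply this at the scales $\log z_j = 2^{-j-1} \log N / (25 \log\log N)$, putting $n$ into the first class $j$ for
  which its $z_j$-rough part is at most $N / z_j^{25 \log\log N}$. An integer in class $j + 1$ has its $z_j$-rough part in
  the window $(N / z_j^{25 \log\log N}, N]$, and rough numbers are sparse enough there for $W \ll \log\log N$ to hold
  for every class. The contributions $\bigl((\log\log N)^{1/2} (\log z_j)^{\alpha_q}\bigr)^q$ form a geometric
  series dominated by $j = 0$.\<close>

section \<open>Mean values of Dirichlet polynomials\<close>

text \<open>Cut-offs are kept by their logarithms: \<open>Y\<close> = log N, \<open>Z\<close> = log
  z, \<open>L\<close> = log log N, and \<open>E\<close> is the logarithm of the room left below N.

  The exponent: f_S H resembles zeta^(1/2), so its mean square is at most of order W Z^(1/4). With a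
  = q/(2-q), |H|^(-2a) resembles |zeta|^a and has mean at most of order Z^(a^2/4). Hoelder combines
  these to (q/2)(1/4) + (1-q/2) a^2/4 = q/(4(2-q)), which is q times \<open>norm_exponent q\<close>.

  The obstacle is the cut at N. The factor 2^(-omega) arises from a complete sum of (-1/2)^omega(d)
  over squarefree z-smooth divisors d of k. For k > N some divisors are missing, the cancellation is
  lost, and only (3/2)^omega is left. Such k have a z-smooth part beyond e^E, and Rankin's trick
  bounds their share by Z^25 e^(-E/Z). Since Z \<le> Y, the choice E = 25 Z L makes this harmless.
  The powers of log log N in the theorem come from this ratio alone: W has order E/Z, and the
  largest Z is Y/(50 L).\<close>

definition chi :: "nat \<Rightarrow> real \<Rightarrow> complex" where
  "chi n t = cis (- (t * ln (real n)))"

definition dpoly :: "nat set \<Rightarrow> (nat \<Rightarrow> real) \<Rightarrow> real \<Rightarrow> complex" where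
  "dpoly S a t = (\<Sum>n\<in>S. of_real (a n) * chi n t)"

text \<open>Zero is excluded because \<open>ln 0 = 0\<close> makes \<open>chi 0\<close> coincide
  with \<open>chi 1\<close>, which would break orthogonality.\<close>

definition is_dpoly :: "(real \<Rightarrow> complex) \<Rightarrow> bool" where
  "is_dpoly F \<longleftrightarrow> (\<exists>S a. finite S \<and> 0 \<notin> S \<and> F = dpoly S a)"

text \<open>Continuity is part of the notion so that every integral over [0, T] exists and the
  integration rules apply.\<close>

definition has_mean :: "(real \<Rightarrow> real) \<Rightarrow> real \<Rightarrow> bool" where
  "has_mean g l \<longleftrightarrow> continuous_on UNIV g \<and> ((\<lambda>T. 1 / T * integral {0..T} g) \<longlongrightarrow> l) at_top"

lemma chi_1 [simp]: "chi (Suc 0) t = 1"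
  by (simp add: chi_def)

lemma norm_chi [simp]: "cmod (chi n t) = 1"
  by (simp add: chi_def)

lemma chi_mult: "m > 0 \<Longrightarrow> n > 0 \<Longrightarrow> chi (m * n) t = chi m t * chi n t"
  by (simp add: chi_def cis_mult ln_mult ring_distribs)

lemma chi_prod:
  assumes "finite A" "\<And>x. x \<in> A \<Longrightarrow> f x > 0"
  shows "chi (\<Prod>x\<in>A. f x) t = (\<Prod>x\<in>A. chi (f x) t)"
  using assms by (induction rule: finite_induct) (auto simp: chi_mult prod_pos)

lemma has_mean_continuous: "has_mean g l \<Longrightarrow> continuous_on A g"
  using continuous_on_subset has_mean_def by blast

lemma has_mean_integrable: "has_mean g l \<Longrightarrow> g integrable_on {a..b}"
  by (intro integrable_continuous_real has_mean_continuous)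

lemma has_mean_const: "has_mean (\<lambda>_. c) c"
proof -
  have "\<forall>\<^sub>F T in at_top. c = 1 / T * integral {0..T} (\<lambda>_::real. c)"
    using eventually_gt_at_top[of 0] by eventually_elim auto
  then have "((\<lambda>T. 1 / T * integral {0..T} (\<lambda>_::real. c)) \<longlongrightarrow> c) at_top"
    by (rule Lim_transform_eventually[OF tendsto_const])
  then show ?thesis by (auto simp: has_mean_def)
qed

lemma has_mean_add:
  assumes "has_mean f k" "has_mean g l"
  shows "has_mean (\<lambda>t. f t + g t) (k + l)"
proof -
  have "((\<lambda>T. 1 / T * integral {0..T} f + 1 / T * integral {0..T} g) \<longlongrightarrow> k + l) at_top"
    using assms by (intro tendsto_add) (auto simp: has_mean_def)
  moreover have "1 / T * integral {0..T} f + 1 / T * integral {0..T} g =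
      1 / T * integral {0..T} (\<lambda>t. f t + g t)" for T
    by (subst integral_add)
       (use assms in \<open>auto intro: has_mean_integrable simp: ring_distribs add_divide_distrib\<close>)
  ultimately show ?thesis
    using assms by (auto simp: has_mean_def intro!: continuous_intros)
qed

lemma has_mean_cmult:
  assumes "has_mean f k"
  shows "has_mean (\<lambda>t. c * f t) (c * k)"
proof -
  have "((\<lambda>T. c * (1 / T * integral {0..T} f)) \<longlongrightarrow> c * k) at_top"
    using assms by (intro tendsto_intros) (auto simp: has_mean_def)
  then show ?thesis
    using assms by (auto simp: has_mean_def algebra_simps intro!: continuous_intros)
qed

lemma has_mean_sum:
  assumes "\<And>i. i \<in> I \<Longrightarrow> has_mean (f i) (k i)"
  shows "has_mean (\<lambda>t. \<Sum>i\<in>I. f i t) (\<Sum>i\<in>I. k i)"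
proof (cases "finite I")
  case True
  then show ?thesis using assms
    by (induction rule: finite_induct) (auto intro: has_mean_add has_mean_const)
qed (auto intro: has_mean_const)

lemma has_mean_le:
  assumes "has_mean f k" "has_mean g l" "\<And>t. f t \<le> g t"
  shows "k \<le> l"
proof (rule tendsto_le)
  show "((\<lambda>T. 1 / T * integral {0..T} f) \<longlongrightarrow> k) at_top"
    and "((\<lambda>T. 1 / T * integral {0..T} g) \<longlongrightarrow> l) at_top"
    using assms by (auto simp: has_mean_def)
  show "\<forall>\<^sub>F T in at_top. 1 / T * integral {0..T} f \<le> 1 / T * integral {0..T} g"
    using eventually_gt_at_top[of 0]
    by eventually_elim
       (use assms in \<open>auto intro!: divide_right_mono integral_le has_mean_integrable\<close>)
qed auto

text \<open>A nonzero frequency has the bounded primitive sin(tw)/w, so its average decays like 1/T.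
  This is the orthogonality of the n^(-it).\<close>

lemma has_mean_cos:
  "has_mean (\<lambda>t. cos (t * w)) (if w = 0 then 1 else 0)"
proof (cases "w = 0")
  case False
  have int: "integral {0..T} (\<lambda>t. cos (t * w)) = sin (T * w) / w" if "T > 0" for T
  proof -
    have "((\<lambda>t. cos (t * w)) has_integral (sin (T * w) / w - sin (0 * w) / w)) {0..T}"
      using False that
      by (intro fundamental_theorem_of_calculus)
         (auto intro!: derivative_eq_intros simp: has_real_derivative_iff_has_vector_derivative[symmetric])
    then show ?thesis by (simp add: integral_unique)
  qed
  have "((\<lambda>T. 1 / T * (sin (T * w) / w)) \<longlongrightarrow> 0) at_top"
  proof (rule Lim_null_comparison)
    show "\<forall>\<^sub>F T in at_top. norm (1 / T * (sin (T * w) / w)) \<le> (1 / \<bar>w\<bar>) / T"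
      using eventually_gt_at_top[of 0]
    proof eventually_elim
      case (elim T)
      have "\<bar>sin (T * w)\<bar> * (1 / (T * \<bar>w\<bar>)) \<le> 1 * (1 / (T * \<bar>w\<bar>))"
        using elim by (intro mult_right_mono) auto
      with elim show ?case by (simp add: abs_mult field_simps)
    qed
    show "((\<lambda>T. (1 / \<bar>w\<bar>) / T) \<longlongrightarrow> 0) at_top"
      by (rule real_tendsto_divide_at_top[OF tendsto_const]) (rule filterlim_ident)
  qed
  moreover have "\<forall>\<^sub>F T in at_top. 1 / T * (sin (T * w) / w) = 1 / T * integral {0..T} (\<lambda>t. cos (t * w))"
    using eventually_gt_at_top[of 0] by eventually_elim (simp add: int)
  ultimately have "((\<lambda>T. 1 / T * integral {0..T} (\<lambda>t. cos (t * w))) \<longlongrightarrow> 0) at_top"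
    by (rule Lim_transform_eventually)
  then show ?thesis using False by (auto simp: has_mean_def intro!: continuous_intros)
qed (simp add: has_mean_const)

lemma cmod_sq_dpoly:
  "(cmod (dpoly S a t))\<^sup>2 = (\<Sum>n\<in>S. \<Sum>m\<in>S. (a n * a m) * cos (t * (ln (real m) - ln (real n))))"
proof -
  have "complex_of_real ((cmod (dpoly S a t))\<^sup>2) =
      (\<Sum>n\<in>S. \<Sum>m\<in>S. of_real (a n * a m) * cis (t * (ln (real m) - ln (real n))))"
    unfolding complex_norm_square dpoly_def cnj_sum sum_product chi_def
    by (auto simp: cis_cnj cis_mult algebra_simps intro!: sum.cong)
  then have "Re (complex_of_real ((cmod (dpoly S a t))\<^sup>2)) =
      Re (\<Sum>n\<in>S. \<Sum>m\<in>S. of_real (a n * a m) * cis (t * (ln (real m) - ln (real n))))"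
    by simp
  then show ?thesis by simp
qed

text \<open>Parseval: in the double sum only pairs with ln m = ln n survive, and ln is injective on
  positive integers.\<close>

lemma has_mean_dpoly:
  assumes "finite S" "0 \<notin> S"
  shows "has_mean (\<lambda>t. (cmod (dpoly S a t))\<^sup>2) (\<Sum>n\<in>S. (a n)\<^sup>2)"
proof -
  have "has_mean (\<lambda>t. \<Sum>n\<in>S. \<Sum>m\<in>S. (a n * a m) * cos (t * (ln (real m) - ln (real n))))
      (\<Sum>n\<in>S. \<Sum>m\<in>S. (a n * a m) * (if ln (real m) - ln (real n) = 0 then 1 else 0))"
    by (intro has_mean_sum has_mean_cmult has_mean_cos)
  moreover have "(\<Sum>m\<in>S. (a n * a m) * (if ln (real m) - ln (real n) = 0 then 1 else 0)) = (a n)\<^sup>2"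
    if "n \<in> S" for n
  proof -
    have "(\<Sum>m\<in>S. (a n * a m) * (if ln (real m) - ln (real n) = 0 then 1 else 0)) =
        (\<Sum>m\<in>S. if n = m then a n * a m else 0)"
    proof (intro sum.cong refl)
      fix m assume "m \<in> S"
      then have "m > 0" "n > 0" using that assms by (auto intro!: Nat.gr0I)
      then show "(a n * a m) * (if ln (real m) - ln (real n) = 0 then 1 else 0) =
          (if n = m then a n * a m else 0)" by auto
    qed
    also have "\<dots> = (a n)\<^sup>2" using that assms by (simp add: power2_eq_square)
    finally show ?thesis .
  qed
  ultimately show ?thesis by (simp add: cmod_sq_dpoly)
qed

lemma dpoly_reindex:
  assumes "finite I" "\<And>i. i \<in> I \<Longrightarrow> k i > 0"
  shows "(\<Sum>i\<in>I. of_real (c i) * chi (k i) t) = dpoly (k ` I) (\<lambda>n. \<Sum>i | i \<in> I \<and> k i = n. c i) t"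
proof -
  have "dpoly (k ` I) (\<lambda>n. \<Sum>i | i \<in> I \<and> k i = n. c i) t =
      (\<Sum>n\<in>k ` I. \<Sum>i | i \<in> I \<and> k i = n. of_real (c i) * chi (k i) t)"
    by (auto simp: dpoly_def sum_distrib_right intro!: sum.cong)
  also have "\<dots> = (\<Sum>i\<in>I. of_real (c i) * chi (k i) t)"
    using assms(1) by (rule sum.image_gen[symmetric])
  finally show ?thesis by simp
qed

lemma is_dpoly_sum:
  assumes "finite I" "\<And>i. i \<in> I \<Longrightarrow> k i > 0"
  shows "is_dpoly (\<lambda>t. \<Sum>i\<in>I. of_real (c i) * chi (k i) t)"
  unfolding is_dpoly_def using assms dpoly_reindex[OF assms]
  by (intro exI[of _ "k ` I"] exI[of _ "\<lambda>n. \<Sum>i | i \<in> I \<and> k i = n. c i"]) fastforce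

lemma is_dpoly_mult:
  assumes "is_dpoly F" "is_dpoly G"
  shows "is_dpoly (\<lambda>t. F t * G t)"
proof -
  obtain S a R b where F: "finite S" "0 \<notin> S" "F = dpoly S a" and G: "finite R" "0 \<notin> R" "G = dpoly R b"
    using assms unfolding is_dpoly_def by blast
  have "F t * G t = (\<Sum>(m, n)\<in>S \<times> R. of_real (a m * b n) * chi (m * n) t)" for t
    unfolding F G dpoly_def sum_product sum.cartesian_product using F(2) G(2)
    by (intro sum.cong) (auto simp: chi_mult, metis chi_mult mult.assoc mult.left_commute not_gr_zero)
  then have *: "(\<lambda>t. F t * G t) = (\<lambda>t. \<Sum>i\<in>S \<times> R. of_real (a (fst i) * b (snd i)) * chi (fst i * snd i) t)"
    by (auto simp: case_prod_unfold)
  show ?thesis unfolding * using F G by (intro is_dpoly_sum) (auto intro!: Nat.gr0I)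
qed

lemma is_dpoly_power:
  assumes "is_dpoly F"
  shows "is_dpoly (\<lambda>t. F t ^ k)"
proof (induction k)
  case 0
  have "(\<lambda>t. F t ^ 0) = dpoly {1} (\<lambda>_. 1)" by (auto simp: dpoly_def)
  then show ?case unfolding is_dpoly_def by (metis finite.emptyI finite_insert singletonD zero_neq_one)
next
  case (Suc k)
  then show ?case using assms by (auto intro: is_dpoly_mult)
qed

lemma has_mean_is_dpoly: "is_dpoly F \<Longrightarrow> \<exists>l. has_mean (\<lambda>t. (cmod (F t))\<^sup>2) l"
  unfolding is_dpoly_def using has_mean_dpoly by blast

lemma is_dpoly_bounded:
  assumes "is_dpoly F"
  obtains B where "\<And>t. cmod (F t) \<le> B"
proof -
  obtain S a where F: "finite S" "0 \<notin> S" "F = dpoly S a"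
    using assms unfolding is_dpoly_def by blast
  have "cmod (F t) \<le> (\<Sum>n\<in>S. \<bar>a n\<bar>)" for t
    unfolding F dpoly_def by (rule sum_norm_le) (simp add: norm_mult)
  then show ?thesis using that by blast
qed

section \<open>Existence of the means of |F|^q\<close>

text \<open>Averaging over [0, T] does not increase the sup norm, so the averages of
  \<open>g\<close> inherit the Cauchy property from uniform approximations that have a mean.\<close>

lemma has_mean_uniform_limit:
  assumes cont: "continuous_on UNIV g"
    and approx: "\<And>e. e > 0 \<Longrightarrow> \<exists>h l. has_mean h l \<and> (\<forall>t. \<bar>g t - h t\<bar> \<le> e)"
  shows "\<exists>l. has_mean g l"
proof -
  let ?M = "\<lambda>f T. 1 / T * integral {0..T} f"
  have close: "\<bar>?M g T - ?M h T\<bar> \<le> e"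
    if h: "has_mean h l" "\<forall>t. \<bar>g t - h t\<bar> \<le> e" and T: "T > 0" for h l e T
  proof -
    have gi: "g integrable_on {0..T}" and hi: "h integrable_on {0..T}"
      using integrable_continuous_real[OF continuous_on_subset[OF cont]] has_mean_integrable[OF h(1)]
      by auto
    have "integral {0..T} (\<lambda>t. g t - h t) = integral {0..T} g - integral {0..T} h"
      using gi hi by (rule integral_diff)
    moreover have "norm (integral {0..T} (\<lambda>t. g t - h t)) \<le> integral {0..T} (\<lambda>t. e)"
      using gi hi h by (intro integral_norm_bound_integral integrable_diff) auto
    ultimately have *: "\<bar>integral {0..T} g - integral {0..T} h\<bar> \<le> T * e"
      using T by simp
    have "\<bar>?M g T - ?M h T\<bar> = \<bar>integral {0..T} g - integral {0..T} h\<bar> / T"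
      using T by (simp add: diff_divide_distrib[symmetric])
    also have "\<dots> \<le> (T * e) / T"
      using T by (intro divide_right_mono *) auto
    also have "\<dots> = e" using T by simp
    finally show ?thesis .
  qed
  have "\<exists>l. ((\<lambda>T. ?M g T) \<longlongrightarrow> l) at_top"
  proof -
    have "cauchy_filter (filtermap (?M g) at_top)"
      unfolding cauchy_filter_metric_filtermap
    proof (intro allI impI)
      fix e :: real assume "e > 0"
      then obtain h l where h: "has_mean h l" "\<forall>t. \<bar>g t - h t\<bar> \<le> e / 4"
        using approx[of "e / 4"] by auto
      have "\<forall>\<^sub>F T in at_top. dist (?M h T) l < e / 4"
        using h \<open>e > 0\<close> unfolding has_mean_def tendsto_iff by (auto elim!: allE[of _ "e/4"])
      then have ev: "\<forall>\<^sub>F T in at_top. T > 0 \<and> dist (?M h T) l < e / 4"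
        using eventually_gt_at_top[of 0] by eventually_elim auto
      show "\<exists>P. eventually P at_top \<and> (\<forall>x y. P x \<and> P y \<longrightarrow> dist (?M g x) (?M g y) < e)"
      proof (intro exI conjI, rule ev, intro allI impI, elim conjE)
        fix x y :: real
        assume "x > 0" "y > 0" and d: "dist (?M h x) l < e / 4" "dist (?M h y) l < e / 4"
        have "\<bar>?M g x - ?M h x\<bar> \<le> e / 4" "\<bar>?M g y - ?M h y\<bar> \<le> e / 4"
          using close[OF h \<open>x > 0\<close>] close[OF h \<open>y > 0\<close>] by auto
        then show "dist (?M g x) (?M g y) < e"
          using d \<open>e > 0\<close> unfolding dist_real_def by linarith
      qed
    qed
    moreover have "filtermap (?M g) at_top \<noteq> bot" by (simp add: filtermap_bot_iff)
    ultimately obtain l where "filtermap (?M g) at_top \<le> nhds l"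
      using complete_uniform[of "UNIV :: real set"] complete_UNIV by (auto simp: complete_uniform)
    then show ?thesis by (auto simp: filterlim_def)
  qed
  then show ?thesis using cont by (auto simp: has_mean_def)
qed

lemma continuous_on_is_dpoly: "is_dpoly F \<Longrightarrow> continuous_on A F"
  unfolding is_dpoly_def dpoly_def[abs_def] chi_def[abs_def] by (auto intro!: continuous_intros)

text \<open>By Weierstrass, $x^{q/2}$ is a uniform limit of polynomials in $x = |F|^2$, and
  $|F|^{2k} = |F^k|^2$.\<close>

lemma has_mean_powr:
  assumes F: "is_dpoly F" and q: "q > 0"
  shows "\<exists>l. has_mean (\<lambda>t. cmod (F t) powr q) l"
proof (rule has_mean_uniform_limit)
  show "continuous_on UNIV (\<lambda>t. cmod (F t) powr q)"
    using q by (intro continuous_on_powr' continuous_on_norm continuous_on_is_dpoly F continuous_intros) auto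
  fix e :: real assume e: "e > 0"
  obtain B where B: "\<And>t. cmod (F t) \<le> B" using is_dpoly_bounded[OF F] by blast
  have "continuous_on {0..B\<^sup>2} (\<lambda>x::real. x powr (q / 2))"
    using q by (intro continuous_on_powr' continuous_intros) auto
  then obtain p where p: "real_polynomial_function p" "\<And>x. x \<in> {0..B\<^sup>2} \<Longrightarrow> \<bar>x powr (q / 2) - p x\<bar> < e"
    using Stone_Weierstrass_real_polynomial_function[of "{0..B\<^sup>2}" "\<lambda>x::real. x powr (q / 2)" e] e
    by auto
  obtain a n where pa: "p = (\<lambda>x. \<Sum>i\<le>n. a i * x ^ i)"
    using real_polynomial_function_imp_sum[OF p(1)] by blast
  have "\<exists>k. \<forall>i. has_mean (\<lambda>t. (cmod (F t ^ i))\<^sup>2) (k i)"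
    using has_mean_is_dpoly[OF is_dpoly_power[OF F]] by (intro choice) auto
  then obtain k where k: "\<And>i. has_mean (\<lambda>t. (cmod (F t ^ i))\<^sup>2) (k i)" by blast
  have "has_mean (\<lambda>t. p ((cmod (F t))\<^sup>2)) (\<Sum>i\<le>n. a i * k i)"
  proof -
    have "(\<lambda>t. p ((cmod (F t))\<^sup>2)) = (\<lambda>t. \<Sum>i\<le>n. a i * (cmod (F t ^ i))\<^sup>2)"
      unfolding pa by (simp add: norm_power power_mult[symmetric] mult.commute)
    then show ?thesis using k by (auto intro!: has_mean_sum has_mean_cmult)
  qed
  moreover have "\<bar>cmod (F t) powr q - p ((cmod (F t))\<^sup>2)\<bar> \<le> e" for t
  proof -
    have "(cmod (F t))\<^sup>2 \<in> {0..B\<^sup>2}" using B[of t] by (auto intro: power_mono)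
    moreover have "((cmod (F t))\<^sup>2) powr (q / 2) = cmod (F t) powr q"
      using powr_powr[of "cmod (F t)" 2 "q/2"] by simp
    ultimately show ?thesis using p(2)[of "(cmod (F t))\<^sup>2"] by simp
  qed
  ultimately show "\<exists>h l. has_mean h l \<and> (\<forall>t. \<bar>cmod (F t) powr q - h t\<bar> \<le> e)" by blast
qed

section \<open>Upper bounds for means\<close>

text \<open>An upper bound for the mean of \<open>g\<close> that does not presuppose that this mean
  exists. Negative powers such as |H|^(-2a) are outside the reach of \<open>has_mean_powr\<close>;
  domination by a function with a mean serves instead.\<close>

definition mean_bdd :: "(real \<Rightarrow> real) \<Rightarrow> real \<Rightarrow> bool" where
  "mean_bdd g B \<longleftrightarrow> (\<exists>G l. has_mean G l \<and> (\<forall>t. g t \<le> G t) \<and> l \<le> B)"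

lemma has_mean_imp_mean_bdd: "has_mean g l \<Longrightarrow> l \<le> B \<Longrightarrow> mean_bdd g B"
  unfolding mean_bdd_def by (intro exI[of _ g] exI[of _ l]) auto

lemma mean_bdd_mono:
  assumes "mean_bdd g B" "\<And>t. f t \<le> g t" "B \<le> C"
  shows "mean_bdd f C"
  using assms unfolding mean_bdd_def by (meson order_trans)

lemma mean_bdd_add:
  assumes "mean_bdd f B" "mean_bdd g C"
  shows "mean_bdd (\<lambda>t. f t + g t) (B + C)"
proof -
  obtain F k G l where "has_mean F k" "\<forall>t. f t \<le> F t" "k \<le> B" "has_mean G l" "\<forall>t. g t \<le> G t" "l \<le> C"
    using assms unfolding mean_bdd_def by blast
  then show ?thesis
    unfolding mean_bdd_def
    by (intro exI[of _ "\<lambda>t. F t + G t"] exI[of _ "k + l"]) (auto intro!: has_mean_add add_mono)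
qed

lemma mean_bdd_cmult:
  assumes "mean_bdd f B" "c \<ge> 0"
  shows "mean_bdd (\<lambda>t. c * f t) (c * B)"
proof -
  obtain F k where "has_mean F k" "\<forall>t. f t \<le> F t" "k \<le> B"
    using assms unfolding mean_bdd_def by blast
  then show ?thesis
    using assms(2) unfolding mean_bdd_def
    by (intro exI[of _ "\<lambda>t. c * F t"] exI[of _ "c * k"]) (auto intro!: has_mean_cmult mult_left_mono)
qed

lemma mean_bdd_const: "c \<le> B \<Longrightarrow> mean_bdd (\<lambda>_. c) B"
  by (rule has_mean_imp_mean_bdd[OF has_mean_const])

lemma mean_bdd_sum:
  assumes "finite I" "\<And>i. i \<in> I \<Longrightarrow> mean_bdd (f i) (B i)"
  shows "mean_bdd (\<lambda>t. \<Sum>i\<in>I. f i t) (\<Sum>i\<in>I. B i)"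
  using assms by (induction rule: finite_induct) (auto intro: mean_bdd_add mean_bdd_const)

lemma mean_bdd_le:
  assumes "has_mean g l" "mean_bdd g B"
  shows "l \<le> B"
  using assms unfolding mean_bdd_def by (meson has_mean_le order_trans)

text \<open>With \<open>X\<close> divided by \<open>A\<close> and \<open>Y\<close> by
  \<open>B\<close>, the pointwise Young inequality bounds the product by a linear combination whose
  mean is at most A^\<theta> B^(1-\<theta>). Hoelder thus follows from linearity and accepts upper
  bounds in place of means.\<close>

lemma mean_bdd_Hoelder:
  assumes X: "mean_bdd X A" and Y: "mean_bdd Y B"
    and pos: "A > 0" "B > 0" "0 < \<theta>" "\<theta> < 1"
    and nn: "\<And>t. X t \<ge> 0" "\<And>t. Y t \<ge> 0"
    and g: "\<And>t. g t \<le> X t powr \<theta> * Y t powr (1 - \<theta>)"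
  shows "mean_bdd g (A powr \<theta> * B powr (1 - \<theta>))"
proof -
  let ?D = "A powr \<theta> * B powr (1 - \<theta>)"
  have 1: "mean_bdd (\<lambda>t. ?D * (\<theta> / A) * X t + ?D * ((1 - \<theta>) / B) * Y t)
      (?D * (\<theta> / A) * A + ?D * ((1 - \<theta>) / B) * B)"
    using pos by (intro mean_bdd_add mean_bdd_cmult X Y) auto
  have 2: "?D * (\<theta> / A) * A + ?D * ((1 - \<theta>) / B) * B = ?D"
    using pos by (simp add: field_simps)
  have 3: "g t \<le> ?D * (\<theta> / A) * X t + ?D * ((1 - \<theta>) / B) * Y t" for t
  proof -
    have "X t powr \<theta> * Y t powr (1 - \<theta>) = ?D * ((X t / A) powr \<theta> * (Y t / B) powr (1 - \<theta>))"
      using pos nn by (simp add: powr_divide)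
    also have "(X t / A) powr \<theta> * (Y t / B) powr (1 - \<theta>) \<le> \<theta> * (X t / A) + (1 - \<theta>) * (Y t / B)"
    proof (cases "X t = 0 \<or> Y t = 0")
      case True
      then have "(X t / A) powr \<theta> * (Y t / B) powr (1 - \<theta>) = 0" by auto
      moreover have "0 \<le> \<theta> * (X t / A) + (1 - \<theta>) * (Y t / B)"
        using pos nn by (intro add_nonneg_nonneg mult_nonneg_nonneg divide_nonneg_pos) auto
      ultimately show ?thesis by (simp only:)
    next
      case False
      then have "X t > 0" "Y t > 0" using nn by (metis less_eq_real_def)+
      then show ?thesis using pos by (intro Youngs_inequality_0) auto
    qed
    finally have "X t powr \<theta> * Y t powr (1 - \<theta>) \<le> ?D * (\<theta> * (X t / A) + (1 - \<theta>) * (Y t / B))"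
      using pos by simp
    with g[of t] show ?thesis by (simp add: algebra_simps)
  qed
  show ?thesis by (rule mean_bdd_mono[OF 1 3]) (simp only: 2 order.refl)
qed

section \<open>Sums over smooth and rough numbers\<close>

text \<open>For positive \<open>n\<close> this is the largest divisor composed of primes in
  \<open>P\<close>: the smooth part for \<open>P = small_primes Z\<close>, the rough part for its
  complement.\<close>

definition prime_part :: "nat set \<Rightarrow> nat \<Rightarrow> nat" where
  "prime_part P n = (\<Prod>p\<in>prime_factors n \<inter> P. p ^ multiplicity p n)"

lemma prime_part_pos [simp]: "prime_part P n > 0"
  unfolding prime_part_def by (rule prod_pos) (auto intro: prime_gt_0_nat)

lemma prime_part_mult_compl: "n > 0 \<Longrightarrow> prime_part P n * prime_part (-P) n = n"
proof -
  assume n: "n > 0"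
  have "prime_part P n * prime_part (-P) n = (\<Prod>p\<in>(prime_factors n \<inter> P) \<union> (prime_factors n \<inter> -P). p ^ multiplicity p n)"
    unfolding prime_part_def by (subst prod.union_disjoint) auto
  also have "(prime_factors n \<inter> P) \<union> (prime_factors n \<inter> -P) = prime_factors n" by auto
  finally show ?thesis using prime_factorization_nat[OF n] by simp
qed

lemma multiplicity_prime_part:
  assumes "prime p" "n > 0"
  shows "multiplicity p (prime_part P n) = (if p \<in> P then multiplicity p n else 0)"
proof -
  have "multiplicity p (prime_part P n) = (if p \<in> prime_factors n \<inter> P then multiplicity p n else 0)"
    unfolding prime_part_def using assms by (intro multiplicity_prod_prime_powers) auto
  then show ?thesis using assms by (auto simp: prime_factors_multiplicity)
qed

lemma prime_factors_prime_part: "n > 0 \<Longrightarrow> prime_factors (prime_part P n) = prime_factors n \<inter> P"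
  by (auto simp: prime_factors_multiplicity multiplicity_prime_part split: if_splits)

lemma prime_part_prime_part:
  assumes "n > 0"
  shows "prime_part Q (prime_part P n) = prime_part (Q \<inter> P) n"
  unfolding prime_part_def[of Q] prime_part_def[of "Q \<inter> P"]
  using assms by (intro prod.cong) (auto simp: prime_factors_prime_part multiplicity_prime_part in_prime_factors_iff)

lemma prime_part_mult:
  assumes "a > 0" "b > 0"
  shows "prime_part P (a * b) = prime_part P a * prime_part P b"
  by (rule multiplicity_eq_nat)
     (use assms in \<open>auto simp: multiplicity_prime_part prime_elem_multiplicity_mult_distrib\<close>)

lemma prime_part_smooth: "n > 0 \<Longrightarrow> prime_factors n \<subseteq> P \<Longrightarrow> prime_part P n = n"
  unfolding prime_part_def using prime_factorization_nat[of n] by (simp add: Int_absorb2)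

lemma prime_part_rough: "prime_factors n \<inter> P = {} \<Longrightarrow> prime_part P n = 1"
  by (simp add: prime_part_def)

text \<open>By unique factorization \<open>n\<close> is recovered from its two parts, so the left
  side is a partial sum of the expanded product on the right.\<close>

lemma sum_prime_part_le:
  fixes g h :: "nat \<Rightarrow> real"
  assumes F: "0 \<notin> F" and A: "finite A" "prime_part P ` F \<subseteq> A" and B: "finite B" "prime_part (-P) ` F \<subseteq> B"
    and nn: "\<And>a. a \<in> A \<Longrightarrow> g a \<ge> 0" "\<And>b. b \<in> B \<Longrightarrow> h b \<ge> 0"
  shows "(\<Sum>n\<in>F. g (prime_part P n) * h (prime_part (-P) n)) \<le> (\<Sum>a\<in>A. g a) * (\<Sum>b\<in>B. h b)"
proof -
  let ?i = "\<lambda>n. (prime_part P n, prime_part (-P) n)"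
  have inj: "inj_on ?i F"
    using F by (intro inj_onI) (metis Pair_inject not_gr_zero prime_part_mult_compl)
  have "(\<Sum>n\<in>F. g (prime_part P n) * h (prime_part (-P) n)) = (\<Sum>x\<in>?i ` F. g (fst x) * h (snd x))"
    by (subst sum.reindex[OF inj]) auto
  also have "\<dots> \<le> (\<Sum>x\<in>A \<times> B. g (fst x) * h (snd x))"
    using A B nn by (intro sum_mono2) auto
  also have "\<dots> = (\<Sum>a\<in>A. g a) * (\<Sum>b\<in>B. h b)"
    by (simp add: sum_product sum.cartesian_product case_prod_unfold)
  finally show ?thesis .
qed

definition omega :: "nat \<Rightarrow> nat" where "omega n = card (prime_factors n)"

lemma omega_prime_part: "n > 0 \<Longrightarrow> omega n = omega (prime_part P n) + omega (prime_part (-P) n)"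
proof -
  assume n: "n > 0"
  have "card ((prime_factors n \<inter> P) \<union> (prime_factors n \<inter> -P)) =
      card (prime_factors n \<inter> P) + card (prime_factors n \<inter> -P)"
    by (rule card_Un_disjoint) auto
  moreover have "(prime_factors n \<inter> P) \<union> (prime_factors n \<inter> -P) = prime_factors n" by auto
  ultimately show ?thesis by (simp add: omega_def prime_factors_prime_part n)
qed

text \<open>The Euler factor at p is 1 + c (x + x^2 + ...) with x = p^(-\<tau>); \<open>c\<close> is
  charged once for every positive power because \<open>omega\<close> counts distinct primes.\<close>

lemma sum_prime_powers_le:
  fixes c \<tau> :: real
  assumes p: "prime p" and c: "c \<ge> 0" "\<tau> > 0" and A: "A = (\<lambda>i. p ^ i) ` {..K}"
  shows "(\<Sum>a\<in>A. c ^ omega a * real a powr (-\<tau>)) \<le> 1 + c / (real p powr \<tau> - 1)"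
proof -
  define x where "x = real p powr (-\<tau>)"
  have p1: "real p > 1" using prime_gt_1_nat[OF p] by simp
  have x: "0 < x" "x < 1" using p1 c by (auto simp: x_def powr_less_one)
  have inj: "inj_on (\<lambda>i. p ^ i) {..K}"
    using prime_gt_1_nat[OF p] by (intro inj_onI) auto
  have omega: "omega (p ^ i) = (if i = 0 then 0 else 1)" for i
    using p by (simp add: omega_def prime_factorization_prime_power)
  have pw: "real (p ^ i) powr (-\<tau>) = x ^ i" for i
  proof -
    have "real (p ^ i) powr (-\<tau>) = (real p powr real i) powr (-\<tau>)"
      using p1 by (simp add: powr_realpow)
    also have "\<dots> = x powr real i" by (simp add: x_def powr_powr mult.commute)
    also have "\<dots> = x ^ i" using x by (simp add: powr_realpow)
    finally show ?thesis .
  qed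
  have "(\<Sum>a\<in>A. c ^ omega a * real a powr (-\<tau>)) = (\<Sum>i\<le>K. c ^ omega (p ^ i) * real (p ^ i) powr (-\<tau>))"
    unfolding A by (subst sum.reindex[OF inj]) auto
  also have "\<dots> = (\<Sum>i\<le>K. (if i = 0 then 1 else c) * x ^ i)"
    by (intro sum.cong refl) (auto simp only: omega pw, auto)
  also have "\<dots> \<le> (\<Sum>i\<le>K. (if i = 0 then 1 - c else 0) + c * x ^ i)"
    by (intro sum_mono) auto
  also have "\<dots> = (1 - c) + c * (\<Sum>i\<le>K. x ^ i)"
    by (simp add: sum.distrib sum_distrib_left)
  also have "(\<Sum>i\<le>K. x ^ i) \<le> 1 / (1 - x)"
  proof -
    have "(\<Sum>i\<le>K. x ^ i) = (1 - x ^ Suc K) / (1 - x)" using x by (simp add: sum_gp0)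
    also have "\<dots> \<le> 1 / (1 - x)" using x by (intro divide_right_mono) auto
    finally show ?thesis .
  qed
  also have "(1 - c) + c * (1 / (1 - x)) = 1 + c * (x / (1 - x))" using x by (simp add: field_simps)
  also have "x / (1 - x) = 1 / (real p powr \<tau> - 1)"
    using x p1 by (simp add: x_def powr_minus field_simps)
  finally show ?thesis using c by (simp add: mult_left_mono)
qed

text \<open>A finite Euler product bound. One prime is split off at each step, and \<open>S\<close>
  varies in the induction because the cofactors prime to p form a new set.\<close>

lemma sum_smooth_le:
  fixes c \<tau> :: real
  assumes "finite P" "\<And>p. p \<in> P \<Longrightarrow> prime p" "c \<ge> 0" "\<tau> > 0"
    "finite S" "0 \<notin> S" "\<And>n. n \<in> S \<Longrightarrow> prime_factors n \<subseteq> P"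
  shows "(\<Sum>n\<in>S. c ^ omega n * real n powr (-\<tau>)) \<le> (\<Prod>p\<in>P. 1 + c / (real p powr \<tau> - 1))"
  using assms
proof (induction P arbitrary: S rule: finite_induct)
  case empty
  have "S \<subseteq> {1}"
  proof
    fix n assume "n \<in> S"
    then have "n > 0" "prime_factors n = {}" using empty by (auto intro!: Nat.gr0I)
    then show "n \<in> {1}" using prime_part_smooth[of n "{}"] by (simp add: prime_part_def)
  qed
  then have "S = {} \<or> S = {1}" by auto
  then show ?case by (auto simp: omega_def)
next
  case (insert p P S)
  let ?F = "\<lambda>n. c ^ omega n * real n powr (-\<tau>)"
  have p: "prime p" using insert by auto
  have pos: "n > 0" if "n \<in> S" for n using that insert by (auto intro!: Nat.gr0I)
  define K where "K = Max ((multiplicity p) ` S)"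
  let ?A = "(\<lambda>i. p ^ i) ` {..K}" and ?B = "prime_part (-{p}) ` S"
  have A: "prime_part {p} ` S \<subseteq> ?A"
  proof
    fix a assume "a \<in> prime_part {p} ` S"
    then obtain n where n: "n \<in> S" "a = prime_part {p} n" by auto
    have "prime_part {p} n = p ^ multiplicity p n"
      by (cases "p \<in> prime_factors n")
         (auto simp: prime_part_def prime_factors_multiplicity p)
    moreover have "multiplicity p n \<le> K" unfolding K_def using n insert by (intro Max_ge) auto
    ultimately show "a \<in> ?A" using n by auto
  qed
  have "(\<Sum>n\<in>S. ?F n) = (\<Sum>n\<in>S. ?F (prime_part {p} n) * ?F (prime_part (-{p}) n))"
  proof (intro sum.cong refl)
    fix n assume "n \<in> S"
    then have n: "n > 0" by (rule pos)
    have "real n powr (-\<tau>) = real (prime_part {p} n * prime_part (-{p}) n) powr (-\<tau>)"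
      using prime_part_mult_compl[OF n] by simp
    also have "\<dots> = real (prime_part {p} n) powr (-\<tau>) * real (prime_part (-{p}) n) powr (-\<tau>)"
      by (simp add: powr_mult)
    finally show "?F n = ?F (prime_part {p} n) * ?F (prime_part (-{p}) n)"
      using omega_prime_part[OF n, of "{p}"] by (simp add: power_add)
  qed
  also have "\<dots> \<le> (\<Sum>a\<in>?A. ?F a) * (\<Sum>b\<in>?B. ?F b)"
    using insert A by (intro sum_prime_part_le) auto
  also have "\<dots> \<le> (1 + c / (real p powr \<tau> - 1)) * (\<Prod>p\<in>P. 1 + c / (real p powr \<tau> - 1))"
  proof (intro mult_mono)
    show "(\<Sum>a\<in>?A. ?F a) \<le> 1 + c / (real p powr \<tau> - 1)"
      using insert p by (intro sum_prime_powers_le) auto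
    show "(\<Sum>b\<in>?B. ?F b) \<le> (\<Prod>p\<in>P. 1 + c / (real p powr \<tau> - 1))"
    proof (rule insert.IH)
      show "0 \<notin> ?B" by (metis imageE less_irrefl prime_part_pos)
      fix b assume "b \<in> ?B"
      then obtain x where "x \<in> S" "b = prime_part (-{p}) x" by blast
      then show "prime_factors b \<subseteq> P"
        using insert.prems(6)[of x] prime_factors_prime_part[OF pos[of x]] by auto
    qed (use insert in auto)
    have "real p powr \<tau> > 1"
      using p \<open>\<tau> > 0\<close> prime_gt_1_nat[OF p] by (intro gr_one_powr) auto
    then show "0 \<le> 1 + c / (real p powr \<tau> - 1)" using \<open>c \<ge> 0\<close> by simp
    show "0 \<le> (\<Sum>b\<in>?B. ?F b)" using \<open>c \<ge> 0\<close> by (intro sum_nonneg) auto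
  qed
  finally show ?case using insert.hyps by simp
qed

section \<open>Chebyshev and Mertens estimates with explicit constants\<close>

text \<open>From n to n + 1 the quotient by d grows by one exactly when d divides n + 1, and
  \<Lambda> sums to ln (n + 1) over these divisors.\<close>

lemma ln_fact_mangoldt: "ln (fact n :: real) = (\<Sum>d=1..n. mangoldt d * real (n div d))"
proof (induction n)
  case (Suc n)
  have "(\<Sum>d=1..Suc n. mangoldt d * real (Suc n div d)) =
      (\<Sum>d=1..Suc n. mangoldt d * real (n div d) + (if d dvd Suc n then mangoldt d else 0))"
    by (intro sum.cong refl) (auto simp: div_Suc dvd_eq_mod_eq_0 ring_distribs)
  also have "\<dots> = (\<Sum>d=1..Suc n. mangoldt d * real (n div d)) + (\<Sum>d=1..Suc n. if d dvd Suc n then mangoldt d else 0)"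
    by (rule sum.distrib)
  also have "(\<Sum>d=1..Suc n. if d dvd Suc n then mangoldt d else 0) = (\<Sum>d | d dvd Suc n. mangoldt d)"
  proof -
    have "{d \<in> {1..Suc n}. d dvd Suc n} = {d. d dvd Suc n}"
      by (auto dest: dvd_imp_le intro!: Nat.gr0I simp: Suc_le_eq)
    then show ?thesis by (simp add: sum.inter_filter[symmetric] del: sum.cl_ivl_Suc)
  qed
  also have "\<dots> = ln (real (Suc n))"
    using mangoldt_sum[of "Suc n", where ?'a = real] by simp
  also have "(\<Sum>d=1..Suc n. mangoldt d * real (n div d)) = ln (fact n)"
    using Suc by simp
  finally show ?case by (simp add: ln_mult)
qed simp

definition chebyshev_psi :: "nat \<Rightarrow> real" where "chebyshev_psi n = (\<Sum>d=1..n. mangoldt d)"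

text \<open>The logarithm of the central binomial coefficient is the sum of \<Lambda>(d) times
  \<open>2 * n div d - 2 * (n div d)\<close>. This factor is 1 for n < d \<le> 2n and never
  negative, while the coefficient is at most 4^n.\<close>

lemma chebyshev_psi_double: "chebyshev_psi (2 * n) \<le> chebyshev_psi n + 2 * real n * ln 2"
proof -
  have "chebyshev_psi (2 * n) - chebyshev_psi n = (\<Sum>d\<in>{n<..2*n}. mangoldt d)"
  proof -
    have "{1..2*n} = {1..n} \<union> {n<..2*n}" by auto
    then have "chebyshev_psi (2 * n) = chebyshev_psi n + (\<Sum>d\<in>{n<..2*n}. mangoldt d)"
      unfolding chebyshev_psi_def by (metis (no_types, lifting) sum.union_disjoint finite_atLeastAtMost
        finite_greaterThanAtMost ivl_disj_int_two(8))
    then show ?thesis by simp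
  qed
  also have "\<dots> = (\<Sum>d\<in>{n<..2*n}. mangoldt d * (real (2 * n div d) - 2 * real (n div d)))"
  proof (intro sum.cong refl)
    fix d assume d: "d \<in> {n<..2*n}"
    then have "2 * n div d = 1" by (intro div_nat_eqI) auto
    moreover have "n div d = 0" using d by simp
    ultimately show "mangoldt d = mangoldt d * (real (2 * n div d) - 2 * real (n div d))" by simp
  qed
  also have "\<dots> \<le> (\<Sum>d\<in>{1..2*n}. mangoldt d * (real (2 * n div d) - 2 * real (n div d)))"
  proof (intro sum_mono2 mult_nonneg_nonneg mangoldt_nonneg)
    fix d :: nat
    have "2 * (n div d) \<le> 2 * n div d"
    proof (cases "d = 0")
      case False
      have "n div d * d \<le> n" by (rule div_times_less_eq_dividend)
      then show ?thesis using False by (simp add: less_eq_div_iff_mult_less_eq)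
    qed simp
    then show "0 \<le> real (2 * n div d) - 2 * real (n div d)" by linarith
  qed auto
  also have "\<dots> = ln (fact (2 * n)) - 2 * (\<Sum>d=1..2*n. mangoldt d * real (n div d))"
    unfolding ln_fact_mangoldt by (simp add: sum_subtractf sum_distrib_left algebra_simps)
  also have "(\<Sum>d=1..2*n. mangoldt d * real (n div d)) = ln (fact n)"
    unfolding ln_fact_mangoldt by (rule sum.mono_neutral_right) auto
  also have "ln (fact (2 * n)) - 2 * ln (fact n) = ln (real (2 * n choose n))"
  proof -
    have "real (2 * n choose n) = fact (2 * n) / (fact n * fact n)"
      using binomial_fact[of n "2 * n", where ?'a = real] by (simp add: mult_2)
    then show ?thesis by (simp add: ln_div ln_mult)
  qed
  also have "\<dots> \<le> ln (2 ^ (2 * n))"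
  proof -
    have "2 * n choose n \<le> 2 ^ (2 * n)" by (rule binomial_le_pow2)
    then have "real (2 * n choose n) \<le> 2 ^ (2 * n)" by (metis of_nat_le_iff of_nat_numeral of_nat_power)
    then show ?thesis by (subst ln_le_cancel_iff) auto
  qed
  also have "\<dots> = 2 * real n * ln 2" by (simp add: ln_realpow)
  finally show ?thesis by simp
qed

text \<open>Doubling k adds 2k ln 2 \<le> 2k to the inductive 4k, while 8k is allowed; the spare 2k
  absorbs \<Lambda>(2k+1) \<le> 2k when n is odd.\<close>

lemma chebyshev_psi_le: "chebyshev_psi n \<le> 4 * real n"
proof (induction n rule: less_induct)
  case (less n)
  have ln2: "ln 2 \<le> (1::real)" using ln_le_minus_one[of "2::real"] by simp
  consider "n \<le> 1" | k where "n = 2 * k" "k \<ge> 1" | k where "n = Suc (2 * k)" "k \<ge> 1"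
    by (cases "even n") (auto elim!: evenE oddE, force+)
  then show ?case
  proof cases
    case 1
    then have "n = 0 \<or> n = 1" by auto
    then show ?thesis by (auto simp: chebyshev_psi_def)
  next
    case 2
    then have "chebyshev_psi k \<le> 4 * real k" by (intro less) auto
    moreover have "real k * ln 2 \<le> real k * 1" using ln2 by (intro mult_left_mono) auto
    ultimately have "chebyshev_psi (2 * k) \<le> 8 * real k" using chebyshev_psi_double[of k] by linarith
    then show ?thesis using 2 by simp
  next
    case 3
    then have "chebyshev_psi k \<le> 4 * real k" by (intro less) auto
    moreover have "real k * ln 2 \<le> real k * 1" using ln2 by (intro mult_left_mono) auto
    ultimately have "chebyshev_psi (2 * k) \<le> 6 * real k" using chebyshev_psi_double[of k] by linarith
    moreover have "chebyshev_psi n = chebyshev_psi (2 * k) + mangoldt n" using 3 by (simp add: chebyshev_psi_def)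
    moreover have "mangoldt n \<le> ln (real n)" using 3 by (intro mangoldt_le) auto
    moreover have "ln (real n) \<le> real n - 1" using 3 by (intro ln_le_minus_one) auto
    ultimately show ?thesis using 3 by simp
  qed
qed

definition mertens_sum :: "nat \<Rightarrow> real" where "mertens_sum n = (\<Sum>d=1..n. mangoldt d / real d)"

text \<open>Rounding n/d to an integer compares n times the sum with ln n!. The total rounding error
  is at most psi(n) \<le> 4n, hence the 4.\<close>

lemma mertens_sum_upper: "n \<ge> 1 \<Longrightarrow> mertens_sum n \<le> ln (real n) + 4"
proof -
  assume n: "n \<ge> 1"
  have "real n * mertens_sum n = (\<Sum>d=1..n. mangoldt d * (real n / real d))"
    by (simp add: mertens_sum_def sum_distrib_left mult_ac)
  also have "\<dots> \<le> (\<Sum>d=1..n. mangoldt d * (real (n div d) + 1))"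
  proof (intro sum_mono mult_left_mono mangoldt_nonneg)
    fix d
    have "real_of_int \<lfloor>real n / real d\<rfloor> = real (n div d)" by (simp add: floor_divide_of_nat_eq)
    then show "real n / real d \<le> real (n div d) + 1" by linarith
  qed
  also have "\<dots> = ln (fact n) + chebyshev_psi n"
    by (simp add: ln_fact_mangoldt chebyshev_psi_def ring_distribs sum.distrib)
  also have "\<dots> \<le> real n * ln (real n) + 4 * real n"
  proof -
    have "fact n \<le> real n ^ n" using fact_le_power[of n, where ?'a = real] by simp
    then have "ln (fact n) \<le> ln (real n ^ n)" using n by (subst ln_le_cancel_iff) auto
    then show ?thesis using chebyshev_psi_le[of n] n by (simp add: ln_realpow)
  qed
  finally have "real n * mertens_sum n \<le> real n * (ln (real n) + 4)" by (simp add: algebra_simps)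
  then show ?thesis using n by simp
qed

lemma ln_fact_ge: "real n * ln (real n) - real n \<le> ln (fact n :: real)"
proof (induction n)
  case (Suc n)
  show ?case
  proof (cases "n = 0")
    case False
    then have "ln (real (Suc n)) - ln (real n) = ln (1 + 1 / real n)"
    proof -
      have "1 + 1 / real n = real (Suc n) / real n" using False by (simp add: field_simps)
      then show ?thesis using False by (simp only: \<open>1 + 1 / real n = real (Suc n) / real n\<close>) (simp add: ln_div del: of_nat_Suc)
    qed
    also have "\<dots> \<le> 1 / real n" by (rule ln_add_one_self_le_self) simp
    finally have "real n * (ln (real (Suc n)) - ln (real n)) \<le> real n * (1 / real n)"
      by (rule mult_left_mono) simp
    moreover have "real n * (1 / real n) = 1" using False by simp
    ultimately have "real n * (ln (real (Suc n)) - ln (real n)) \<le> 1" by linarith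
    moreover have "ln (fact (Suc n) :: real) = ln (real (Suc n)) + ln (fact n)" by (simp add: ln_mult)
    moreover have "real (Suc n) = real n + 1" by simp
    ultimately show ?thesis using Suc by (simp only: ring_distribs)
  qed simp
qed simp

lemma mertens_sum_lower: "n \<ge> 1 \<Longrightarrow> ln (real n) - 1 \<le> mertens_sum n"
proof -
  assume n: "n \<ge> 1"
  have "real n * (ln (real n) - 1) \<le> ln (fact n)" using ln_fact_ge[of n] by (simp add: algebra_simps)
  also have "\<dots> \<le> (\<Sum>d=1..n. mangoldt d * (real n / real d))"
    unfolding ln_fact_mangoldt
    by (intro sum_mono mult_left_mono mangoldt_nonneg of_nat_div_le_of_nat)
  also have "\<dots> = real n * mertens_sum n" by (simp add: mertens_sum_def sum_distrib_left mult_ac)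
  finally show ?thesis using n by simp
qed

lemma mangoldt_interval_le:
  fixes A B :: real
  assumes AB: "0 < A" "A \<le> B" and D: "\<And>d. d \<in> D \<Longrightarrow> A < real d \<and> real d \<le> B"
  shows "(\<Sum>d\<in>D. mangoldt d / real d) \<le> ln (B / A) + 6"
proof -
  have lnBA: "ln (B / A) = ln B - ln A" using AB by (simp add: ln_div)
  consider "A \<ge> 1" | "A < 1" "B \<ge> 1" | "B < 1" by linarith
  then show ?thesis
  proof cases
    case 1
    define a b where "a = nat \<lfloor>A\<rfloor>" and "b = nat \<lfloor>B\<rfloor>"
    have a: "a \<ge> 1" "real a \<le> A" "A < real a + 1" using 1 unfolding a_def by linarith+
    then have a2: "A \<le> 2 * real a" by simp
    have b: "b \<ge> a" "real b \<le> B" using AB 1 unfolding a_def b_def by (auto intro: nat_mono floor_mono)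
    have "D \<subseteq> {a<..b}"
    proof
      fix d assume "d \<in> D"
      then have "A < real d" "real d \<le> B" using D by auto
      then show "d \<in> {a<..b}" using AB by (auto simp: a_def b_def le_nat_floor nat_less_iff floor_less_iff)
    qed
    then have "(\<Sum>d\<in>D. mangoldt d / real d) \<le> (\<Sum>d\<in>{a<..b}. mangoldt d / real d)"
      by (intro sum_mono2) (auto simp: mangoldt_nonneg)
    also have "\<dots> = mertens_sum b - mertens_sum a"
    proof -
      have "{1..b} = {1..a} \<union> {a<..b}" using b by auto
      then have "mertens_sum b = mertens_sum a + (\<Sum>d\<in>{a<..b}. mangoldt d / real d)"
        unfolding mertens_sum_def by (metis (no_types, lifting) sum.union_disjoint finite_atLeastAtMost
          finite_greaterThanAtMost ivl_disj_int_two(8))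
      then show ?thesis by simp
    qed
    also have "\<dots> \<le> ln (real b) + 4 - (ln (real a) - 1)"
      using mertens_sum_upper[of b] mertens_sum_lower[of a] a b by linarith
    also have "ln (real b) \<le> ln B" using a b by (subst ln_le_cancel_iff) linarith+
    finally have "(\<Sum>d\<in>D. mangoldt d / real d) \<le> ln B + 4 - (ln (real a) - 1)" by simp
    moreover have "ln A \<le> ln (2 * real a)" using a a2 AB by (subst ln_le_cancel_iff) auto
    then have "ln A - 1 \<le> ln (real a)" using a ln_le_minus_one[of "2::real"] by (simp add: ln_mult)
    ultimately show ?thesis using lnBA by linarith
  next
    case 2
    define b where "b = nat \<lfloor>B\<rfloor>"
    have b: "b \<ge> 1" "real b \<le> B" using 2 unfolding b_def by linarith+
    have "D \<subseteq> {1..b}"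
    proof
      fix d assume "d \<in> D"
      then have "A < real d" "real d \<le> B" using D by auto
      then show "d \<in> {1..b}" using AB by (cases "d = 0") (auto simp: b_def le_nat_floor)
    qed
    then have "(\<Sum>d\<in>D. mangoldt d / real d) \<le> mertens_sum b"
      unfolding mertens_sum_def by (intro sum_mono2) (auto simp: mangoldt_nonneg)
    also have "\<dots> \<le> ln (real b) + 4" using b by (intro mertens_sum_upper)
    also have "ln (real b) \<le> ln B" using b by (subst ln_le_cancel_iff) linarith+
    finally have "(\<Sum>d\<in>D. mangoldt d / real d) \<le> ln B + 4" by simp
    moreover have "ln A \<le> 0" using 2 AB by simp
    ultimately show ?thesis using lnBA by linarith
  next
    case 3
    have "D = {}"
    proof (rule ccontr)
      assume "D \<noteq> {}"
      then obtain d where "d \<in> D" by blast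
      then have "A < real d" "real d \<le> B" using D by auto
      then show False using 3 AB by (cases "d = 0") auto
    qed
    moreover have "ln (B / A) \<ge> 0" using AB by simp
    ultimately show ?thesis by simp
  qed
qed

text \<open>Partial summation as an induction: with the boundary term
  \<open>mertens_sum n / ln (real n)\<close> subtracted, a step costs \<open>mertens_sum n\<close>
  times the drop of 1/ln, which is at most the growth of ln ln n - 4/ln n.\<close>

lemma sum_mangoldt_div_ln_le:
  assumes "n \<ge> 2"
  shows "(\<Sum>d=2..n. mangoldt d / (real d * ln (real d))) \<le> ln (ln (real n)) + 8"
proof -
  \<comment> \<open>With this constant the case n = 2, whose left side vanishes, is an
    equality.\<close>
  let ?K = "4 / ln 2 - ln (ln 2) :: real"
  have "(\<Sum>d=2..n. mangoldt d / (real d * ln (real d))) - mertens_sum n / ln (real n)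
      \<le> ln (ln (real n)) - 4 / ln (real n) + ?K"
    using assms
  proof (induction n rule: dec_induct)
    case base
    have "mertens_sum 2 = mangoldt 2 / 2" by (simp add: mertens_sum_def numeral_2_eq_2)
    then show ?case by simp
  next
    case (step n)
    let ?a = "ln (real n)" and ?b = "ln (real (Suc n))"
    have ab: "0 < ?a" "?a < ?b" using step by auto
    have S: "(\<Sum>d=2..Suc n. mangoldt d / (real d * ln (real d))) =
      (\<Sum>d=2..n. mangoldt d / (real d * ln (real d))) + mangoldt (Suc n) / (real (Suc n) * ?b)"
      using step by (simp add: numeral_2_eq_2)
    have M: "mertens_sum (Suc n) / ?b = mertens_sum n / ?b + mangoldt (Suc n) / (real (Suc n) * ?b)"
      by (simp add: mertens_sum_def add_divide_distrib)
    have "mertens_sum n * (1 / ?a - 1 / ?b) \<le> (?a + 4) * (1 / ?a - 1 / ?b)"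
      using ab step by (intro mult_right_mono mertens_sum_upper) (auto simp: field_simps)
    also have "\<dots> = (1 - ?a / ?b) + (4 / ?a - 4 / ?b)"
    proof -
      have "(x + 4) * (1 / x - 1 / y) = (1 - x / y) + (4 / x - 4 / y)" if "0 < x" "x < y" for x y :: real
        using that by (simp add: field_simps)
      then show ?thesis using ab by blast
    qed
    also have "1 - ?a / ?b \<le> ln ?b - ln ?a"
    proof -
      have "1 - x / y \<le> ln y - ln x" if "0 < x" "x < y" for x y :: real
        using ln_le_minus_one[of "x / y"] that by (simp add: ln_div)
      then show ?thesis using ab by blast
    qed
    finally have "mertens_sum n / ?a - mertens_sum n / ?b \<le> ln ?b - ln ?a + (4 / ?a - 4 / ?b)"
      by (simp add: algebra_simps)
    with step.IH S M show ?case by linarith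
  qed
  moreover have "mertens_sum n / ln (real n) \<le> 1 + 4 / ln (real n)"
  proof -
    have "mertens_sum n / ln (real n) \<le> (ln (real n) + 4) / ln (real n)"
      using assms by (intro divide_right_mono mertens_sum_upper) auto
    then show ?thesis using assms by (simp add: add_divide_distrib)
  qed
  moreover have "?K \<le> 7"
  proof -
    have l: "ln 2 \<ge> (2/3 :: real)" using ln2_ge_two_thirds by simp
    then have "4 / ln 2 \<le> 4 / (2/3 :: real)" by (intro divide_left_mono) auto
    then have "4 / ln 2 \<le> (6 :: real)" by simp
    moreover have "ln (2/3) \<le> ln (ln 2 :: real)" using l by (subst ln_le_cancel_iff) auto
    moreover have "ln (2/3 :: real) \<ge> 1 - 3/2" using ln_le_minus_one[of "3/2 :: real"] ln_div[of 3 "2::real"] ln_div[of 2 "3::real"] by simp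
    ultimately show ?thesis by argo
  qed
  ultimately show ?thesis by linarith
qed

section \<open>Reciprocal sums and Euler products over the primes up to exp Z\<close>

text \<open>The cut-off is given by its logarithm, so that Mertens' theorem reads ln Z + O(1) and
  Euler products become powers of \<open>Z\<close>.\<close>

definition small_primes :: "real \<Rightarrow> nat set" where
  "small_primes Z = {p. prime p \<and> ln (real p) \<le> Z}"

lemma small_primes_eq: "Z \<ge> 0 \<Longrightarrow> small_primes Z = {p. prime p \<and> p \<le> nat \<lfloor>exp Z\<rfloor>}"
proof -
  have "ln (real p) \<le> Z \<longleftrightarrow> p \<le> nat \<lfloor>exp Z\<rfloor>" if "prime p" for p
  proof -
    have "ln (real p) \<le> Z \<longleftrightarrow> real p \<le> exp Z"
      using prime_gt_0_nat[OF that] by (metis exp_le_cancel_iff exp_ln of_nat_0_less_iff)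
    also have "\<dots> \<longleftrightarrow> p \<le> nat \<lfloor>exp Z\<rfloor>" by (simp add: le_nat_iff le_floor_iff)
    finally show ?thesis .
  qed
  then show ?thesis by (auto simp: small_primes_def)
qed

lemma finite_small_primes [simp]: "finite (small_primes Z)"
proof -
  have "small_primes Z \<subseteq> small_primes (max Z 0)" by (auto simp: small_primes_def)
  moreover have "small_primes (max Z 0) \<subseteq> {..nat \<lfloor>exp (max Z 0)\<rfloor>}"
    by (subst small_primes_eq) auto
  ultimately show ?thesis by (meson finite_atMost finite_subset)
qed

lemma prime_small_primes: "p \<in> small_primes Z \<Longrightarrow> prime p" by (simp add: small_primes_def)

lemma small_primes_mono: "Z \<le> Y \<Longrightarrow> small_primes Z \<subseteq> small_primes Y" by (auto simp: small_primes_def)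

lemma sum_inverse_small_primes_le:
  assumes Z: "Z \<ge> 1"
  shows "(\<Sum>p\<in>small_primes Z. 1 / real p) \<le> ln Z + 8"
proof -
  define n where "n = nat \<lfloor>exp Z\<rfloor>"
  have "exp Z \<ge> 2" using exp_ge_add_one_self[of Z] Z by linarith
  then have n: "n \<ge> 2" "real n \<le> exp Z" unfolding n_def by linarith+
  have sub: "small_primes Z \<subseteq> {2..n}"
    using Z by (auto simp: small_primes_eq n_def[symmetric] dest: prime_ge_2_nat)
  have "(\<Sum>p\<in>small_primes Z. 1 / real p) = (\<Sum>p\<in>small_primes Z. mangoldt p / (real p * ln (real p)))"
  proof (intro sum.cong refl)
    fix p assume "p \<in> small_primes Z"
    then have "prime p" by (rule prime_small_primes)
    then show "1 / real p = mangoldt p / (real p * ln (real p))" using prime_gt_1_nat[of p] by simp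
  qed
  also have "\<dots> \<le> (\<Sum>d=2..n. mangoldt d / (real d * ln (real d)))"
    by (intro sum_mono2 sub) (auto simp: mangoldt_nonneg)
  also have "\<dots> \<le> ln (ln (real n)) + 8" by (rule sum_mangoldt_div_ln_le[OF n(1)])
  also have "ln (ln (real n)) \<le> ln Z"
  proof -
    have "ln (real n) \<le> Z" using n by (metis exp_le_cancel_iff exp_ln of_nat_0_less_iff order_less_le_trans zero_less_numeral)
    then show ?thesis using n Z by (subst ln_le_cancel_iff) auto
  qed
  finally show ?thesis by simp
qed

lemma sum_inverse_pronic_le:
  assumes "finite P" "\<And>p. p \<in> P \<Longrightarrow> p \<ge> 2"
  shows "(\<Sum>p\<in>P. 1 / (real p * (real p - 1))) \<le> 1"
proof -
  define N where "N = Max (insert 2 P)"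
  have sub: "P \<subseteq> {2..N}" and N: "N \<ge> 2" using assms by (auto simp: N_def)
  have "(\<Sum>p\<in>P. 1 / (real p * (real p - 1))) \<le> (\<Sum>p=2..N. 1 / (real p * (real p - 1)))"
    by (intro sum_mono2 sub) auto
  also have "\<dots> = 1 - 1 / real N" using N
  proof (induction N rule: dec_induct)
    case (step n)
    have "(\<Sum>p=2..Suc n. 1 / (real p * (real p - 1))) = 1 - 1 / real n + 1 / ((real n + 1) * real n)"
      using step by (simp add: add.commute)
    also have "\<dots> = 1 - 1 / real (Suc n)"
    proof -
      have g: "1 - 1 / x + 1 / ((x + 1) * x) = 1 - 1 / (x + 1)" if "x > 0" for x :: real
        using that diff_frac_eq[of x "x + 1" 1 1] by (simp add: mult.commute)
      show ?thesis using step g[of "real n"] by (simp add: add.commute)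
    qed
    finally show ?case .
  qed simp
  finally show ?thesis using N by (simp add: order.trans)
qed

lemma prod_one_plus_le:
  assumes "finite P" "\<And>p. p \<in> P \<Longrightarrow> p \<ge> (2::nat)" "c \<ge> 0"
  shows "(\<Prod>p\<in>P. 1 + c / (real p - 1)) \<le> exp (c * ((\<Sum>p\<in>P. 1 / real p) + 1))"
proof -
  have "(\<Prod>p\<in>P. 1 + c / (real p - 1)) \<le> (\<Prod>p\<in>P. exp (c / (real p - 1)))"
  proof (intro prod_mono conjI)
    fix p assume "p \<in> P"
    then have "real p \<ge> 2" using assms by fastforce
    then show "0 \<le> 1 + c / (real p - 1)" using assms by simp
  qed (simp add: exp_ge_add_one_self add.commute)
  also have "\<dots> = exp (\<Sum>p\<in>P. c / (real p - 1))" using assms by (simp add: exp_sum)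
  also have "(\<Sum>p\<in>P. c / (real p - 1)) = c * ((\<Sum>p\<in>P. 1 / real p) + (\<Sum>p\<in>P. 1 / (real p * (real p - 1))))"
    unfolding sum.distrib[symmetric] sum_distrib_left
  proof (intro sum.cong refl)
    fix p assume "p \<in> P"
    then have "real p \<ge> 2" using assms by fastforce
    then show "c / (real p - 1) = c * (1 / real p + 1 / (real p * (real p - 1)))" by (simp add: field_simps)
  qed
  also have "\<dots> \<le> c * ((\<Sum>p\<in>P. 1 / real p) + 1)"
    using assms sum_inverse_pronic_le[of P] by (intro mult_left_mono add_left_mono) auto
  finally show ?thesis by simp
qed

text \<open>Euler's argument: every k \<le> e^Z is a product of primes up to e^Z, so the harmonic
  sum, which is at least \<open>Z\<close>, lies below the Euler product.\<close>

lemma sum_inverse_small_primes_ge: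
  assumes Z: "Z \<ge> 1"
  shows "ln Z - 1 \<le> (\<Sum>p\<in>small_primes Z. 1 / real p)"
proof -
  define n where "n = nat \<lfloor>exp Z\<rfloor>"
  have "real n + 1 \<ge> exp Z" unfolding n_def by linarith
  then have "Z \<le> ln (real n + 1)" by (subst ln_ge_iff) auto
  also have "\<dots> \<le> harm n" by (rule ln_le_harm)
  also have "harm n = (\<Sum>k\<in>{1..n}. 1 ^ omega k * real k powr (-1))"
    by (simp add: harm_def powr_minus)
  also have "\<dots> \<le> (\<Prod>p\<in>small_primes Z. 1 + 1 / (real p powr 1 - 1))"
  proof (intro sum_smooth_le)
    fix k assume k: "k \<in> {1..n}"
    show "prime_factors k \<subseteq> small_primes Z"
    proof
      fix p assume p: "p \<in> prime_factors k"
      then have "prime p" "p dvd k" by auto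
      then have "p \<le> n" using k dvd_imp_le[of p k] by auto
      then show "p \<in> small_primes Z" using \<open>prime p\<close> Z by (simp add: small_primes_eq n_def)
    qed
  qed (auto simp: prime_small_primes)
  also have "\<dots> \<le> exp (1 * ((\<Sum>p\<in>small_primes Z. 1 / real p) + 1))"
    using prod_one_plus_le[of "small_primes Z" 1] by (simp add: prime_ge_2_nat prime_small_primes)
  finally have "ln Z \<le> ln (exp ((\<Sum>p\<in>small_primes Z. 1 / real p) + 1))"
    using Z by (subst ln_le_cancel_iff) auto
  then show ?thesis by simp
qed

text \<open>Mertens' product over e^Z < p \<le> e^Y. The 10 collects 8 and 1 from the two reciprocal
  sums and 1 from the passage from 1/p to 1/(p-1).\<close>

lemma prod_small_primes_diff_le:
  assumes "1 \<le> Z" "Z \<le> Y"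
  shows "(\<Prod>p\<in>small_primes Y - small_primes Z. 1 + 1 / (real p - 1)) \<le> exp 10 * (Y / Z)"
proof -
  have "(\<Sum>p\<in>small_primes Y - small_primes Z. 1 / real p) = (\<Sum>p\<in>small_primes Y. 1 / real p) - (\<Sum>p\<in>small_primes Z. 1 / real p)"
    using assms by (intro sum_diff small_primes_mono) auto
  also have "\<dots> \<le> ln Y + 8 - (ln Z - 1)"
    using sum_inverse_small_primes_le[of Y] sum_inverse_small_primes_ge[of Z] assms by linarith
  also have "\<dots> = ln (Y / Z) + 9" using assms by (simp add: ln_div)
  finally have s: "1 * ((\<Sum>p\<in>small_primes Y - small_primes Z. 1 / real p) + 1) \<le> 10 + ln (Y / Z)" by simp
  have "(\<Prod>p\<in>small_primes Y - small_primes Z. 1 + 1 / (real p - 1)) \<le> exp (1 * ((\<Sum>p\<in>small_primes Y - small_primes Z. 1 / real p) + 1))"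
    by (intro prod_one_plus_le) (auto simp: prime_ge_2_nat prime_small_primes)
  also have "\<dots> \<le> exp (10 + ln (Y / Z))" using s by (simp only: exp_le_cancel_iff)
  also have "\<dots> = exp 10 * (Y / Z)" using assms by (simp add: exp_add)
  finally show ?thesis .
qed

lemma sum_inverse_rough_le:
  assumes Z: "1 \<le> Z" "Z \<le> Y" and S: "finite S" "0 \<notin> S"
    "\<And>m. m \<in> S \<Longrightarrow> prime_factors m \<subseteq> small_primes Y - small_primes Z"
  shows "(\<Sum>m\<in>S. 1 / real m) \<le> exp 10 * (Y / Z)"
proof -
  have "(\<Sum>m\<in>S. 1 / real m) = (\<Sum>m\<in>S. 1 ^ omega m * real m powr (-1))"
    by (simp add: powr_minus inverse_eq_divide)
  also have "\<dots> \<le> (\<Prod>p\<in>small_primes Y - small_primes Z. 1 + 1 / (real p powr 1 - 1))"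
    using S by (intro sum_smooth_le) (auto simp: prime_small_primes)
  also have "\<dots> \<le> exp 10 * (Y / Z)" using prod_small_primes_diff_le[OF Z] by simp
  finally show ?thesis .
qed

lemma prime_factors_subset_small_primes:
  assumes "n > 0" "ln (real n) \<le> Y"
  shows "prime_factors n \<subseteq> small_primes Y"
proof
  fix p assume p: "p \<in> prime_factors n"
  then have "prime p" "p dvd n" by auto
  then have "p > 0" "p \<le> n" using assms by (auto simp: prime_gt_0_nat dvd_imp_le)
  then have "ln (real p) \<le> ln (real n)" by (subst ln_le_cancel_iff) auto
  then show "p \<in> small_primes Y" using assms \<open>prime p\<close> by (simp add: small_primes_def)
qed

text \<open>A Chebyshev-type argument replaces the upper bound sieve: since $\ln m = \sum_{d \mid m} \Lambda(d)$
  is large, one factor $d$ of $m$ can be summed over a window by Mertens' theorem.\<close>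

lemma sum_inverse_rough_window_le:
  assumes Z: "1 \<le> Z" "Z \<le> Y" and E: "0 \<le> E" "E \<le> Y / 2"
    and S: "finite S" "0 \<notin> S" "\<And>m. m \<in> S \<Longrightarrow> prime_factors m \<inter> small_primes Z = {}"
      "\<And>m. m \<in> S \<Longrightarrow> Y - E < ln (real m) \<and> ln (real m) \<le> Y"
  shows "(\<Sum>m\<in>S. 1 / real m) \<le> 2 * exp 10 * ((E + 6) / Z)"
proof -
  have pos: "m > 0" if "m \<in> S" for m using that S by (auto intro!: Nat.gr0I)
  define T where "T = (SIGMA m:S. {d. d dvd m})"
  define R where "R = (\<lambda>(m, d). m div d) ` T"
  define D where "D = (\<lambda>a. {d. a * d \<in> S})"
  have finT: "finite T" unfolding T_def using S pos by (intro finite_SigmaI) (auto intro: finite_divisors_nat)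
  then have finR: "finite R" unfolding R_def by simp
  have Rprop: "a > 0 \<and> prime_factors a \<subseteq> small_primes Y - small_primes Z" if "a \<in> R" for a
  proof -
    obtain m d where md: "m \<in> S" "d dvd m" "a = m div d" using \<open>a \<in> R\<close> by (auto simp: R_def T_def)
    have m: "m > 0" using pos md by blast
    then have a: "a > 0" "a dvd m" using md by (auto elim!: dvdE)
    then have sub: "prime_factors a \<subseteq> prime_factors m" using m by (intro dvd_prime_factors) auto
    moreover have "prime_factors m \<subseteq> small_primes Y" using m S md by (intro prime_factors_subset_small_primes) auto
    ultimately show ?thesis using S(3)[OF md(1)] a by auto
  qed
  have finD: "finite (D a)" if "a > 0" for a
  proof -
    have "D a \<subseteq> (\<lambda>m. m div a) ` S"
    proof
      fix d assume "d \<in> D a"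
      then show "d \<in> (\<lambda>m. m div a) ` S" using that unfolding D_def
        by (intro image_eqI[of _ _ "a * d"]) auto
    qed
    then show ?thesis using S(1) finite_subset by blast
  qed
  have Y0: "Y > 0" using Z by simp
  \<comment> \<open>\<open>E \<le> Y / 2\<close> gives ln m \<ge> Y/2. The factor gained cancels the
    \<open>Y\<close> of the Mertens product at the end, which leaves (E + 6)/Z.\<close>
  have "(Y / 2) * (\<Sum>m\<in>S. 1 / real m) \<le> (\<Sum>m\<in>S. ln (real m) / real m)"
    unfolding sum_distrib_left
  proof (intro sum_mono)
    fix m assume m: "m \<in> S"
    then have "Y / 2 \<le> ln (real m)" using S(4)[OF m] E by simp
    then have "Y / 2 / real m \<le> ln (real m) / real m" by (rule divide_right_mono) simp
    then show "Y / 2 * (1 / real m) \<le> ln (real m) / real m" by simp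
  qed
  also have "\<dots> = (\<Sum>m\<in>S. \<Sum>d\<in>{d. d dvd m}. mangoldt d / real m)"
  proof (intro sum.cong refl)
    fix m assume "m \<in> S"
    then show "ln (real m) / real m = (\<Sum>d\<in>{d. d dvd m}. mangoldt d / real m)"
      using mangoldt_sum[of m, where ?'a = real] pos by (simp add: sum_divide_distrib[symmetric])
  qed
  also have "\<dots> = (\<Sum>(m, d)\<in>T. mangoldt d / real m)"
    unfolding T_def using S pos by (intro sum.Sigma) (auto intro: finite_divisors_nat)
  also have "\<dots> = (\<Sum>(a, d)\<in>(SIGMA a:R. D a). 1 / real a * (mangoldt d / real d))"
  proof (rule sum.reindex_bij_witness[of _ "\<lambda>(a, d). (a * d, d)" "\<lambda>(m, d). (m div d, d)"])
    fix x assume "x \<in> T"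
    then show "(case case x of (m, d) \<Rightarrow> (m div d, d) of (a, d) \<Rightarrow> (a * d, d)) = x"
      by (auto simp: T_def)
    show "(case x of (m, d) \<Rightarrow> (m div d, d)) \<in> (SIGMA a:R. D a)"
      using \<open>x \<in> T\<close> by (force simp: T_def R_def D_def)
    show "(case case x of (m, d) \<Rightarrow> (m div d, d) of (a, d) \<Rightarrow> 1 / real a * (mangoldt d / real d)) =
       (case x of (m, d) \<Rightarrow> mangoldt d / real m)"
    proof -
      obtain m d where x: "x = (m, d)" "m \<in> S" "d dvd m" using \<open>x \<in> T\<close> by (auto simp: T_def)
      then show ?thesis by (simp add: real_of_nat_div)
    qed
  next
    fix x assume "x \<in> (SIGMA a:R. D a)"
    then obtain a d where x: "x = (a, d)" "a \<in> R" "a * d \<in> S" by (auto simp: D_def)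
    then have "d > 0" using pos[of "a * d"] by auto
    then show "(case case x of (a, d) \<Rightarrow> (a * d, d) of (m, d) \<Rightarrow> (m div d, d)) = x" using x by auto
    show "(case x of (a, d) \<Rightarrow> (a * d, d)) \<in> T" using x by (auto simp: T_def)
  qed
  also have "\<dots> = (\<Sum>a\<in>R. \<Sum>d\<in>D a. 1 / real a * (mangoldt d / real d))"
    using finR finD Rprop by (intro sum.Sigma[symmetric]) auto
  \<comment> \<open>For a fixed cofactor a, the divisor d runs through a window whose endpoints have
    ratio e^E, so Mertens gives E + 6 whatever a is.\<close>
  also have "\<dots> \<le> (\<Sum>a\<in>R. 1 / real a * (E + 6))"
    unfolding sum_distrib_left[symmetric]
  proof (intro sum_mono mult_left_mono)
    fix a assume a: "a \<in> R"
    then have a0: "real a > 0" using Rprop by auto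
    have "(\<Sum>d\<in>D a. mangoldt d / real d) \<le> ln ((exp Y / real a) / (exp (Y - E) / real a)) + 6"
    proof (rule mangoldt_interval_le)
      show "0 < exp (Y - E) / real a" using a0 by simp
      show "exp (Y - E) / real a \<le> exp Y / real a" using a0 E by (intro divide_right_mono) auto
      fix d assume "d \<in> D a"
      then have m: "a * d \<in> S" by (simp add: D_def)
      have "real (a * d) > 0" using pos[OF m] by simp
      then have "exp (Y - E) < real (a * d)" "real (a * d) \<le> exp Y"
        using S(4)[OF m] by (metis exp_less_cancel_iff exp_ln, metis exp_le_cancel_iff exp_ln)
      then show "exp (Y - E) / real a < real d \<and> real d \<le> exp Y / real a"
        using a0 by (simp add: field_simps)
    qed
    also have "(exp Y / real a) / (exp (Y - E) / real a) = exp E" using a0 by (simp add: exp_diff)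
    finally show "(\<Sum>d\<in>D a. mangoldt d / real d) \<le> E + 6" by simp
  qed auto
  also have "\<dots> = (E + 6) * (\<Sum>a\<in>R. 1 / real a)" by (simp add: sum_distrib_left mult.commute)
  also have "\<dots> \<le> (E + 6) * (exp 10 * (Y / Z))"
    using E Rprop by (intro mult_left_mono sum_inverse_rough_le Z finR) fastforce+
  finally have "(2 / Y) * ((Y / 2) * (\<Sum>m\<in>S. 1 / real m)) \<le> (2 / Y) * ((E + 6) * (exp 10 * (Y / Z)))"
    using Y0 by (intro mult_left_mono) auto
  then show ?thesis using Y0 by (simp add: mult_ac)
qed

section \<open>The weight\<close>

text \<open>Taylor's formula with third-order remainder. Every intermediate point has 1 + t \<ge>
  2/5, so the power is at most (5/2)^4 < 40, and the coefficient a(a+1)(a+2)/6 is at most 1.\<close>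

lemma powr_neg_le_cubic:
  fixes v a :: real
  assumes a: "0 < a" "a \<le> 1" and v: "-3/5 \<le> v" "v \<le> 1"
  shows "(1 + v) powr (-a) \<le> 1 - a * v + a * (a + 1) / 2 * v\<^sup>2 + 40 * \<bar>v\<bar> ^ 3"
proof (cases "v = 0")
  case False
  define diff where "diff = (\<lambda>m t. (if m = 0 then 1 else if m = 1 then -a else if m = 2 then a * (a + 1)
     else - (a * (a + 1) * (a + 2))) * (1 + t) powr (-a - real m))"
  have "\<exists>t. (if v < 0 then v < t \<and> t < 0 else 0 < t \<and> t < v) \<and>
    (1 + v) powr (-a) = (\<Sum>m<3. (diff m 0 / fact m) * (v - 0)^m) + (diff 3 t / fact 3) * (v - 0)^3"
  proof (rule Taylor[where a = "-3/5" and b = 1])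
    show "diff 0 = (\<lambda>t. (1 + t) powr (-a))" by (simp add: diff_def)
    show "\<forall>m t. m < 3 \<and> - 3 / 5 \<le> t \<and> t \<le> 1 \<longrightarrow> DERIV (diff m) t :> diff (Suc m) t"
    proof (intro allI impI, elim conjE)
      fix m :: nat and t :: real
      assume m: "m < 3" and t: "-3/5 \<le> t" "t \<le> 1"
      have "DERIV (\<lambda>t. (1 + t) powr (-a - real m)) t :> (-a - real m) * (1 + t) powr (-a - real m - 1)"
        using t by (auto intro!: derivative_eq_intros)
      then have d: "DERIV (\<lambda>t. c * (1 + t) powr (-a - real m)) t :>
          c * ((-a - real m) * (1 + t) powr (-a - real m - 1))" for c
        by (rule DERIV_cmult)
      have "m = 0 \<or> m = 1 \<or> m = 2" using m by auto
      then show "DERIV (diff m) t :> diff (Suc m) t"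
        unfolding diff_def
        by (elim disjE; intro DERIV_cong[OF d]) (auto simp: algebra_simps)
    qed
  qed (use v False in auto)
  then obtain t where t: "if v < 0 then v < t \<and> t < 0 else 0 < t \<and> t < v"
    and eq: "(1 + v) powr (-a) = (\<Sum>m<3. (diff m 0 / fact m) * v^m) + (diff 3 t / fact 3) * v^3"
    by auto
  have t1: "1 + t \<ge> 2/5" using t v by (auto split: if_splits)
  have "(1 + t) powr (-a - 3) \<le> (2/5) powr (-a - 3)"
    using t1 a by (intro powr_mono2') auto
  also have "\<dots> \<le> (2/5) powr (-4)" using a by (intro powr_mono') auto
  also have "\<dots> = (5/2) ^ 4" by (simp add: powr_minus powr_numeral field_simps)
  finally have p: "(1 + t) powr (-a - 3) \<le> 40" by (simp add: power4_eq_xxxx)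
  have c: "0 \<le> a * (a + 1) * (a + 2)" "a * (a + 1) * (a + 2) \<le> 1 * 2 * 3"
    using a mult_mono[of "a * (a + 1)" "1 * 2" "a + 2" 3] mult_mono[of a 1 "a + 1" 2] by auto
  have "diff 3 t / fact 3 * v ^ 3 = - (a * (a + 1) * (a + 2) / 6 * (1 + t) powr (-a - 3) * v ^ 3)"
    by (simp add: diff_def fact_numeral)
  also have "\<dots> \<le> \<bar>a * (a + 1) * (a + 2) / 6 * (1 + t) powr (-a - 3) * v ^ 3\<bar>" by linarith
  also have "\<dots> = (a * (a + 1) * (a + 2) / 6) * (1 + t) powr (-a - 3) * \<bar>v\<bar> ^ 3"
    using a by (simp add: abs_mult power_abs)
  also have "\<dots> \<le> 1 * 40 * \<bar>v\<bar> ^ 3"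
    using c p by (intro mult_right_mono mult_mono) auto
  finally have "diff 3 t / fact 3 * v ^ 3 \<le> 40 * \<bar>v\<bar> ^ 3" by simp
  moreover have "(\<Sum>m<3. (diff m 0 / fact m) * v^m) = 1 - a * v + a * (a + 1) / 2 * v\<^sup>2"
    by (simp add: diff_def eval_nat_numeral)
  ultimately show ?thesis using eq by linarith
qed simp

text \<open>The polynomial $1 + au + \frac{a(a+1)}2 u^2$ is the start of the Taylor expansion of $(1-u)^{-a}$.\<close>

lemma norm_powr_neg_le_taylor:
  fixes u :: complex and a :: real
  assumes a: "0 < a" "a \<le> 1" and u: "cmod u \<le> 9/25"
  shows "cmod (1 - u) powr (-2 * a) \<le>
    (1 + 2400 * cmod u ^ 3) * (cmod (1 + of_real a * u + of_real (a * (a + 1) / 2) * u\<^sup>2))\<^sup>2"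
proof -
  define r c d m where "r = cmod u" and "c = Re u" and "d = Im u" and "m = a * (a + 1) / 2"
  define Q where "Q = 1 + of_real a * u + of_real m * u\<^sup>2"
  have r: "0 \<le> r" "r \<le> 9/25" using u by (auto simp: r_def)
  have r2: "r\<^sup>2 = c\<^sup>2 + d\<^sup>2" by (simp add: r_def c_def d_def cmod_power2)
  have cr: "\<bar>c\<bar> \<le> r" unfolding c_def r_def by (rule abs_Re_le_cmod)
  have m: "0 < m" "m \<le> 1"
  proof -
    have "a * (a + 1) \<le> 1 * 2" using a by (intro mult_mono) auto
    then show "m \<le> 1" by (simp add: m_def)
    show "0 < m" using a by (simp add: m_def)
  qed
  \<comment> \<open>Since |1 - u|^2 = 1 + v, the claim reduces to the real function (1 + v)^(-a);
    |u| \<le> 9/25 keeps \<open>v\<close> within [-3/5, 1].\<close>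
  define v where "v = r\<^sup>2 - 2 * c"
  have n1u: "(cmod (1 - u))\<^sup>2 = 1 + v"
    unfolding cmod_power2 v_def r2 by (simp add: c_def d_def power2_eq_square algebra_simps)
  have r2r: "r\<^sup>2 \<le> 9/25 * r" using r mult_right_mono[OF r(2) r(1)] by (simp add: power2_eq_square)
  have vabs: "\<bar>v\<bar> \<le> 59/25 * r" 
  proof -
    have "c \<le> r" "- c \<le> r" using cr by auto
    then show ?thesis unfolding v_def using r2r r(1) zero_le_power2[of r] by (intro abs_leI) linarith+
  qed
  have vlow: "-3/5 \<le> v"
  proof -
    have "v \<ge> r\<^sup>2 - 2 * r" using cr by (simp add: v_def)
    moreover have "r\<^sup>2 - 2 * r = (1 - r)\<^sup>2 - 1" by (simp add: power2_eq_square algebra_simps)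
    moreover have "(1 - r)\<^sup>2 \<ge> (16/25)\<^sup>2" using r by (intro power_mono) auto
    ultimately show ?thesis by (simp add: power2_eq_square)
  qed
  have "cmod (1 - u) powr (-2 * a) = ((cmod (1 - u))\<^sup>2) powr (-a)"
    using powr_powr[of "cmod (1 - u)" 2 "-a"] by simp
  also have "\<dots> = (1 + v) powr (-a)" by (simp only: n1u)
  also have "\<dots> \<le> 1 - a * v + m * v\<^sup>2 + 40 * \<bar>v\<bar> ^ 3"
    unfolding m_def using a vlow vabs r by (intro powr_neg_le_cubic) auto
  also have "\<bar>v\<bar> ^ 3 \<le> (59/25 * r) ^ 3" using vabs by (intro power_mono) auto
  also have "(59/25 * r) ^ 3 \<le> (14::real) * r ^ 3"
    unfolding power_mult_distrib using r by (intro mult_right_mono) (auto simp: power3_eq_cube)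
  also have "1 - a * v + m * v\<^sup>2 \<le> (cmod Q)\<^sup>2 + 7 * r ^ 3"
  proof -
    have "(cmod Q)\<^sup>2 = (1 + a * c + m * (c\<^sup>2 - d\<^sup>2))\<^sup>2 + (a * d + m * (2 * c * d))\<^sup>2"
      unfolding cmod_power2 Q_def by (simp add: c_def d_def power2_eq_square algebra_simps)
    also have "\<dots> = (1 - a * v + m * v\<^sup>2) + (a\<^sup>2 + a - 2 * m) * r\<^sup>2 + (2 * a * m + 4 * m) * c * r\<^sup>2 + (m\<^sup>2 - m) * (r\<^sup>2)\<^sup>2"
      unfolding v_def r2 by algebra
    \<comment> \<open>The value of \<open>m\<close> removes the r^2 term, so the two sides differ
      only from third order on.\<close>
    also have "a\<^sup>2 + a - 2 * m = 0" by (simp add: m_def power2_eq_square algebra_simps)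
    finally have Q: "(cmod Q)\<^sup>2 = (1 - a * v + m * v\<^sup>2) + (2 * a * m + 4 * m) * c * r\<^sup>2 + (m\<^sup>2 - m) * (r\<^sup>2)\<^sup>2"
      by simp
    have "\<bar>(2 * a * m + 4 * m) * c * r\<^sup>2\<bar> \<le> 6 * r * r\<^sup>2"
    proof -
      have "2 * a * m + 4 * m \<le> 6" using a m mult_mono[of a 1 m 1] by simp
      moreover have "0 \<le> 2 * a * m + 4 * m" using a m by simp
      ultimately show ?thesis using cr r unfolding abs_mult by (intro mult_mono) auto
    qed
    moreover have "(m\<^sup>2 - m) * (r\<^sup>2)\<^sup>2 \<ge> - (1 * (1 * r ^ 3))"
    proof -
      have "(m - m\<^sup>2) * (r * r ^ 3) \<le> 1 * (1 * r ^ 3)"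
        using m zero_le_power2[of m] r by (intro mult_mono[of _ 1] mult_right_mono) (linarith | simp)+
      moreover have "(m\<^sup>2 - m) * (r\<^sup>2)\<^sup>2 = - ((m - m\<^sup>2) * (r * r ^ 3))" by algebra
      ultimately show ?thesis by linarith
    qed
    moreover have "6 * r * r\<^sup>2 = 6 * r ^ 3" by algebra
    ultimately show ?thesis using Q by linarith
  qed
  finally have 1: "cmod (1 - u) powr (-2 * a) \<le> (cmod Q)\<^sup>2 + 567 * r ^ 3" by simp
  \<comment> \<open>A lower bound for |Q| turns the additive error into a factor, the form that
    survives a product over primes. Here 567 = 40 * 14 + 7 is below 2400/4.\<close>
  have "cmod Q \<ge> 1/2"
  proof -
    have "cmod (1 + (of_real a * u + of_real m * u\<^sup>2)) \<ge> cmod 1 - cmod (of_real a * u + of_real m * u\<^sup>2)"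
      by (rule norm_diff_ineq)
    moreover have "cmod (of_real a * u + of_real m * u\<^sup>2) \<le> a * r + m * r\<^sup>2"
      by (rule order_trans[OF norm_triangle_ineq]) (use a m in \<open>simp add: norm_mult norm_power r_def\<close>)
    moreover have "a * r \<le> 1 * (9/25)" using a r by (intro mult_mono) auto
    moreover have "m * r\<^sup>2 \<le> 1 * (9/25)\<^sup>2" using m r by (intro mult_mono power_mono) auto
    ultimately have "cmod (1 + (of_real a * u + of_real m * u\<^sup>2)) \<ge> 1/2" by (simp add: power2_eq_square)
    then show ?thesis by (simp add: Q_def add.assoc)
  qed
  then have "(cmod Q)\<^sup>2 \<ge> (1/2)\<^sup>2" by (intro power_mono) auto
  then have "2400 * r ^ 3 * (cmod Q)\<^sup>2 \<ge> 2400 * r ^ 3 * (1/4)"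
    using r by (intro mult_left_mono) (auto simp: power2_eq_square)
  then have "(cmod Q)\<^sup>2 + 567 * r ^ 3 \<le> (1 + 2400 * r ^ 3) * (cmod Q)\<^sup>2"
    using zero_le_power[OF r(1), of 3] by (simp only: ring_distribs)
  with 1 show ?thesis unfolding Q_def r_def m_def by linarith
qed

lemma has_mean_inj:
  assumes I: "finite I" "inj_on k I" "\<And>i. i \<in> I \<Longrightarrow> k i > 0"
  shows "has_mean (\<lambda>t. (cmod (\<Sum>i\<in>I. of_real (c i) * chi (k i) t))\<^sup>2) (\<Sum>i\<in>I. (c i)\<^sup>2)"
proof -
  let ?a = "\<lambda>n. c (inv_into I k n)"
  have "has_mean (\<lambda>t. (cmod (dpoly (k ` I) ?a t))\<^sup>2) (\<Sum>n\<in>k ` I. (?a n)\<^sup>2)"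
    using I by (intro has_mean_dpoly) (auto, metis less_irrefl)
  moreover have "dpoly (k ` I) ?a t = (\<Sum>i\<in>I. of_real (c i) * chi (k i) t)" for t
    unfolding dpoly_def using I by (subst sum.reindex) (auto intro!: sum.cong)
  moreover have "(\<Sum>n\<in>k ` I. (?a n)\<^sup>2) = (\<Sum>i\<in>I. (c i)\<^sup>2)"
    using I by (subst sum.reindex) (auto intro!: sum.cong)
  ultimately show ?thesis by simp
qed

text \<open>Expansion gives one term for each exponent vector from P to {0, 1, 2}. The resulting
  integers are distinct by unique factorization, so Parseval applies and the sum of squares factors
  again.\<close>

lemma has_mean_prod_quadratic:
  fixes a b :: "nat \<Rightarrow> real"
  assumes P: "finite P" "\<And>p. p \<in> P \<Longrightarrow> prime p"
  shows "has_mean (\<lambda>t. (cmod (\<Prod>p\<in>P. 1 + of_real (a p) * chi p t + of_real (b p) * (chi p t)\<^sup>2))\<^sup>2)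
    (\<Prod>p\<in>P. 1 + (a p)\<^sup>2 + (b p)\<^sup>2)"
proof -
  define c where "c = (\<lambda>p (j::nat). if j = 0 then 1 else if j = 1 then a p else b p)"
  define I where "I = PiE P (\<lambda>_. {..<3::nat})"
  define k where "k = (\<lambda>g. \<Prod>p\<in>P. p ^ g p :: nat)"
  have pos: "p > 0" if "p \<in> P" for p using P(2)[OF that] by (rule prime_gt_0_nat)
  have three: "{..<3::nat} = {0, 1, 2}" by auto
  have chi_pow: "chi (p ^ j) t = chi p t ^ j" if "p > 0" for p j t
    using that by (induction j) (auto simp: chi_mult)
  have "inj_on k I"
  proof (intro inj_onI)
    fix g h assume g: "g \<in> I" and h: "h \<in> I" and eq: "k g = k h"
    have "multiplicity p (k f) = f p" if "p \<in> P" for p f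
      unfolding k_def using P that by (subst multiplicity_prod_prime_powers) auto
    then have "g p = h p" if "p \<in> P" for p using eq that by metis
    then show "g = h" using g h unfolding I_def by (intro PiE_ext) auto
  qed
  moreover have "finite I" unfolding I_def using P by (intro finite_PiE) auto
  moreover have "k g > 0" for g unfolding k_def using pos by (intro prod_pos) auto
  ultimately have "has_mean (\<lambda>t. (cmod (\<Sum>g\<in>I. of_real (\<Prod>p\<in>P. c p (g p)) * chi (k g) t))\<^sup>2)
      (\<Sum>g\<in>I. (\<Prod>p\<in>P. c p (g p))\<^sup>2)"
    by (intro has_mean_inj) auto
  moreover have "(\<Sum>g\<in>I. of_real (\<Prod>p\<in>P. c p (g p)) * chi (k g) t) =
      (\<Prod>p\<in>P. 1 + of_real (a p) * chi p t + of_real (b p) * (chi p t)\<^sup>2)" for t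
  proof -
    have "(\<Prod>p\<in>P. \<Sum>j\<in>{..<3}. of_real (c p j) * chi p t ^ j) =
        (\<Sum>g\<in>I. \<Prod>p\<in>P. of_real (c p (g p)) * chi p t ^ g p)"
      unfolding I_def using P by (intro prod_sum_PiE) auto
    also have "\<dots> = (\<Sum>g\<in>I. of_real (\<Prod>p\<in>P. c p (g p)) * chi (k g) t)"
      unfolding k_def using P pos by (simp add: chi_prod chi_pow prod.distrib)
    finally show ?thesis by (simp add: three c_def add.assoc)
  qed
  moreover have "(\<Sum>g\<in>I. (\<Prod>p\<in>P. c p (g p))\<^sup>2) = (\<Prod>p\<in>P. 1 + (a p)\<^sup>2 + (b p)\<^sup>2)"
  proof -
    have "(\<Prod>p\<in>P. \<Sum>j\<in>{..<3}. (c p j)\<^sup>2) = (\<Sum>g\<in>I. \<Prod>p\<in>P. (c p (g p))\<^sup>2)"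
      unfolding I_def using P by (intro prod_sum_PiE) auto
    then show ?thesis by (simp add: three c_def prod_power_distrib add.assoc)
  qed
  ultimately show ?thesis by simp
qed

definition weight_term :: "nat \<Rightarrow> real \<Rightarrow> complex" where
  "weight_term p t = of_real (real p powr (-1/2) / 2) * chi p t"

lemma norm_weight_term: "cmod (weight_term p t) = real p powr (-1/2) / 2"
  by (simp add: weight_term_def norm_mult)

text \<open>The worst prime is 2, with norm 1/(2 sqrt 2) < 0.36; 25/18 is the lower bound for sqrt 2
  that fits 9/25.\<close>

lemma norm_weight_term_le: "prime p \<Longrightarrow> cmod (weight_term p t) \<le> 9/25"
proof -
  assume "prime p"
  then have "real p \<ge> 2" using prime_ge_2_nat[of p] by simp
  then have "real p powr (-1/2) \<le> 2 powr (-1/2)" by (intro powr_mono2') auto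
  also have "2 powr (-1/2) = 1 / sqrt (2::real)" by (simp add: powr_minus powr_half_sqrt field_simps)
  also have "\<dots> \<le> 1 / (25/18)"
  proof -
    have "(25/18)\<^sup>2 \<le> (2::real)" by (simp add: power2_eq_square)
    then have "25/18 \<le> sqrt (2::real)" by (rule real_le_rsqrt)
    then show ?thesis by (intro divide_left_mono) auto
  qed
  finally show ?thesis by (simp add: norm_weight_term)
qed

definition weight :: "nat set \<Rightarrow> real \<Rightarrow> complex" where
  "weight P t = (\<Prod>p\<in>P. 1 - weight_term p t)"

lemma weight_nonzero: "finite P \<Longrightarrow> (\<And>p. p \<in> P \<Longrightarrow> prime p) \<Longrightarrow> weight P t \<noteq> 0"
proof -
  assume P: "finite P" "\<And>p. p \<in> P \<Longrightarrow> prime p"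
  have "1 - weight_term p t \<noteq> 0" if "p \<in> P" for p
    using norm_weight_term_le[OF P(2)[OF that], of t] by auto
  then show ?thesis using P by (simp add: weight_def)
qed

text \<open>Each factor is compared with its quadratic Taylor polynomial. The cubic errors multiply
  to a constant because p^(-3/2) is summable, and the polynomial has local mean 1 + a^2/(4p) +
  O(p^(-2)). \<open>D\<close> precedes \<open>a\<close> and \<open>Z\<close> because one constant
  must serve all scales.\<close>

lemma mean_bdd_weight_powr:
  "\<exists>D>0. \<forall>a Z. 0 < a \<longrightarrow> a \<le> 1 \<longrightarrow> 1 \<le> Z \<longrightarrow>
     mean_bdd (\<lambda>t. cmod (weight (small_primes Z) t) powr (-2 * a)) (D * Z powr (a\<^sup>2 / 4))"
proof -
  define s where "s = (\<Sum>n::nat. real n powr (-3/2))"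
  have summ: "summable (\<lambda>n::nat. real n powr (-3/2))" by (simp add: summable_real_powr_iff)
  \<comment> \<open>300 is 2400/8, the 1/8 coming from the cube of p^(-1/2)/2; 3 bounds 8 a^2/4 +
    1.\<close>
  define D where "D = exp (300 * s) * exp 3"
  have "mean_bdd (\<lambda>t. cmod (weight (small_primes Z) t) powr (-2 * a)) (D * Z powr (a\<^sup>2 / 4))"
    if a: "0 < a" "a \<le> 1" and Z: "1 \<le> Z" for a Z
  proof -
    define r where "r = (\<lambda>p::nat. real p powr (-1/2) / 2)"
    define m where "m = a * (a + 1) / 2"
    define Q where "Q = (\<lambda>t. \<Prod>p\<in>small_primes Z. 1 + of_real (a * r p) * chi p t + of_real (m * (r p)\<^sup>2) * (chi p t)\<^sup>2)"
    have m: "0 < m" "m \<le> 1" using a mult_mono[of a 1 "a + 1" 2] by (auto simp: m_def)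
    have rp: "0 \<le> r p" "(r p)\<^sup>2 = 1 / (4 * real p)" "r p ^ 3 = real p powr (-3/2) / 8" if "p \<in> small_primes Z" for p
    proof -
      have p: "real p > 0" using prime_gt_0_nat[OF prime_small_primes[OF that]] by simp
      show "0 \<le> r p" by (simp add: r_def)
      show "(r p)\<^sup>2 = 1 / (4 * real p)"
        using p by (simp add: r_def power_divide powr_power powr_minus field_simps)
      show "r p ^ 3 = real p powr (-3/2) / 8"
        using p by (simp add: r_def power_divide powr_power)
    qed
    have prodQ: "(\<Prod>p\<in>small_primes Z. 1 + (a * r p)\<^sup>2 + (m * (r p)\<^sup>2)\<^sup>2) \<le> exp 3 * Z powr (a\<^sup>2 / 4)"
    proof -
      have "(\<Prod>p\<in>small_primes Z. 1 + (a * r p)\<^sup>2 + (m * (r p)\<^sup>2)\<^sup>2) \<le>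
          (\<Prod>p\<in>small_primes Z. exp (a\<^sup>2 / 4 * (1 / real p) + 1 / (real p * (real p - 1))))"
      proof (intro prod_mono conjI)
        fix p assume p: "p \<in> small_primes Z"
        have p2: "real p \<ge> 2" using prime_ge_2_nat[OF prime_small_primes[OF p]] by simp
        have "(m * (r p)\<^sup>2)\<^sup>2 \<le> (1 * (r p)\<^sup>2)\<^sup>2" using m by (intro power_mono mult_right_mono) auto
        also have "\<dots> = 1 / (16 * (real p * real p))"
          using rp(2)[OF p] by (simp add: power2_eq_square)
        also have "\<dots> \<le> 1 / (real p * (real p - 1))"
        proof (rule divide_left_mono)
          show "real p * (real p - 1) \<le> 16 * (real p * real p)"
            using p2 mult_left_mono[of "real p - 1" "16 * real p" "real p"] by simp
        qed (use p2 in auto)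
        finally have "(a * r p)\<^sup>2 + (m * (r p)\<^sup>2)\<^sup>2 \<le> a\<^sup>2 / 4 * (1 / real p) + 1 / (real p * (real p - 1))"
          using rp(2)[OF p] by (simp add: power_mult_distrib)
        then show "1 + (a * r p)\<^sup>2 + (m * (r p)\<^sup>2)\<^sup>2 \<le> exp (a\<^sup>2 / 4 * (1 / real p) + 1 / (real p * (real p - 1)))"
          using exp_ge_add_one_self[of "a\<^sup>2 / 4 * (1 / real p) + 1 / (real p * (real p - 1))"] by linarith
        show "0 \<le> 1 + (a * r p)\<^sup>2 + (m * (r p)\<^sup>2)\<^sup>2" by (simp add: add_nonneg_nonneg)
      qed
      also have "\<dots> = exp (a\<^sup>2 / 4 * (\<Sum>p\<in>small_primes Z. 1 / real p) + (\<Sum>p\<in>small_primes Z. 1 / (real p * (real p - 1))))"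
        by (simp add: exp_sum[symmetric] sum.distrib sum_distrib_left)
      also have "\<dots> \<le> exp (a\<^sup>2 / 4 * (ln Z + 8) + 1)"
      proof -
        have "(\<Sum>p\<in>small_primes Z. 1 / (real p * (real p - 1))) \<le> 1"
          by (intro sum_inverse_pronic_le) (auto simp: prime_ge_2_nat prime_small_primes)
        moreover have "a\<^sup>2 / 4 * (\<Sum>p\<in>small_primes Z. 1 / real p) \<le> a\<^sup>2 / 4 * (ln Z + 8)"
          using sum_inverse_small_primes_le[OF Z] by (intro mult_left_mono) auto
        ultimately show ?thesis by simp
      qed
      also have "\<dots> \<le> exp (3 + a\<^sup>2 / 4 * ln Z)"
        using a power_mono[of a 1 2] by (simp add: algebra_simps)
      also have "\<dots> = exp 3 * Z powr (a\<^sup>2 / 4)" using Z by (simp add: exp_add powr_def)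
      finally show ?thesis .
    qed
    have C: "(\<Prod>p\<in>small_primes Z. 1 + 2400 * r p ^ 3) \<le> exp (300 * s)"
    proof -
      have "(\<Prod>p\<in>small_primes Z. 1 + 2400 * r p ^ 3) \<le> (\<Prod>p\<in>small_primes Z. exp (300 * real p powr (-3/2)))"
      proof (intro prod_mono conjI)
        fix p assume p: "p \<in> small_primes Z"
        show "0 \<le> 1 + 2400 * r p ^ 3" using rp(1)[OF p] by simp
        have "2400 * r p ^ 3 = 300 * real p powr (-3/2)" using rp(3)[OF p] by simp
        then show "1 + 2400 * r p ^ 3 \<le> exp (300 * real p powr (-3/2))"
          using exp_ge_add_one_self[of "300 * real p powr (-3/2)"] by linarith
      qed
      also have "\<dots> = exp (300 * (\<Sum>p\<in>small_primes Z. real p powr (-3/2)))"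
        by (simp add: exp_sum[symmetric] sum_distrib_left)
      also have "\<dots> \<le> exp (300 * s)"
        unfolding s_def using sum_le_suminf[OF summ, of "small_primes Z"] by simp
      finally show ?thesis .
    qed
    have "has_mean (\<lambda>t. (cmod (Q t))\<^sup>2) (\<Prod>p\<in>small_primes Z. 1 + (a * r p)\<^sup>2 + (m * (r p)\<^sup>2)\<^sup>2)"
      unfolding Q_def by (intro has_mean_prod_quadratic) (auto simp: prime_small_primes)
    then have Qb: "mean_bdd (\<lambda>t. exp (300 * s) * (cmod (Q t))\<^sup>2) (exp (300 * s) * (exp 3 * Z powr (a\<^sup>2 / 4)))"
      using prodQ by (intro mean_bdd_cmult has_mean_imp_mean_bdd) auto
    show ?thesis
    proof (rule mean_bdd_mono[OF Qb])
      fix t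
      have "cmod (weight (small_primes Z) t) powr (-2 * a) = (\<Prod>p\<in>small_primes Z. cmod (1 - weight_term p t) powr (-2 * a))"
        by (simp add: weight_def prod_norm[symmetric] prod_powr_distrib)
      also have "\<dots> \<le> (\<Prod>p\<in>small_primes Z. (1 + 2400 * r p ^ 3) *
          (cmod (1 + of_real (a * r p) * chi p t + of_real (m * (r p)\<^sup>2) * (chi p t)\<^sup>2))\<^sup>2)"
      proof (intro prod_mono conjI)
        fix p assume p: "p \<in> small_primes Z"
        have "cmod (1 - weight_term p t) powr (-2 * a) \<le> (1 + 2400 * cmod (weight_term p t) ^ 3) *
            (cmod (1 + of_real a * weight_term p t + of_real (a * (a + 1) / 2) * (weight_term p t)\<^sup>2))\<^sup>2"
          by (rule norm_powr_neg_le_taylor[OF a norm_weight_term_le[OF prime_small_primes[OF p]]])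
        then show "cmod (1 - weight_term p t) powr (-2 * a) \<le> (1 + 2400 * r p ^ 3) *
            (cmod (1 + of_real (a * r p) * chi p t + of_real (m * (r p)\<^sup>2) * (chi p t)\<^sup>2))\<^sup>2"
          unfolding norm_weight_term m_def[symmetric]
          by (simp add: weight_term_def r_def power_mult_distrib power_divide mult_ac)
      qed simp
      also have "\<dots> = (\<Prod>p\<in>small_primes Z. 1 + 2400 * r p ^ 3) * (cmod (Q t))\<^sup>2"
        by (simp add: Q_def prod.distrib prod_norm[symmetric] prod_power_distrib)
      also have "\<dots> \<le> exp (300 * s) * (cmod (Q t))\<^sup>2"
        using C by (intro mult_right_mono) auto
      finally show "cmod (weight (small_primes Z) t) powr (-2 * a) \<le> exp (300 * s) * (cmod (Q t))\<^sup>2" .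
    qed (simp add: D_def)
  qed
  moreover have "D > 0" by (simp add: D_def)
  ultimately show ?thesis by blast
qed

section \<open>Numbers with a prescribed rough part\<close>

lemma weight_expand:
  assumes P: "finite P" "\<And>p. p \<in> P \<Longrightarrow> prime p"
  shows "weight P t = (\<Sum>D\<in>Pow P. of_real ((-1/2) ^ card D * real (\<Prod>D) powr (-1/2)) * chi (\<Prod>D) t)"
proof -
  have "weight P t = (\<Prod>p\<in>P. - weight_term p t + 1)" by (simp add: weight_def)
  also have "\<dots> = (\<Sum>D\<in>Pow P. (\<Prod>p\<in>D. - weight_term p t) * (\<Prod>p\<in>P - D. 1))"
    by (rule prod_add[OF P(1)])
  also have "\<dots> = (\<Sum>D\<in>Pow P. of_real ((-1/2) ^ card D * real (\<Prod>D) powr (-1/2)) * chi (\<Prod>D) t)"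
  proof (intro sum.cong refl)
    fix D assume "D \<in> Pow P"
    then have "D \<subseteq> P" by simp
    then have D: "finite D" "\<And>p. p \<in> D \<Longrightarrow> p > 0"
      using P(1) finite_subset[of D P] P(2) prime_gt_0_nat by blast+
    have "(\<Prod>p\<in>D. - weight_term p t) = (\<Prod>p\<in>D. of_real ((-1/2) * real p powr (-1/2)) * chi p t)"
      by (simp add: weight_term_def)
    also have "\<dots> = of_real (\<Prod>p\<in>D. (-1/2) * real p powr (-1/2)) * chi (\<Prod>D) t"
    proof -
      have "chi (\<Prod>D) t = (\<Prod>p\<in>D. chi p t)" using chi_prod[of D "\<lambda>p. p" t, OF D] by simp
      then show ?thesis by (simp only: of_real_prod) (rule prod.distrib)
    qed
    also have "(\<Prod>p\<in>D. (-1/2) * real p powr (-1/2)) = (-1/2) ^ card D * real (\<Prod>D) powr (-1/2)"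
      by (simp only: prod.distrib prod_constant of_nat_prod) (simp add: prod_powr_distrib)
    finally show "(\<Prod>p\<in>D. - weight_term p t) * (\<Prod>p\<in>P - D. 1) =
        of_real ((-1/2) ^ card D * real (\<Prod>D) powr (-1/2)) * chi (\<Prod>D) t" by simp
  qed
  finally show ?thesis .
qed

lemma sum_Pow_power_card:
  fixes x :: real
  assumes "finite A"
  shows "(\<Sum>D\<in>Pow A. x ^ card D) = (x + 1) ^ card A"
  using prod_add[OF assms, of "\<lambda>_. x" "\<lambda>_. 1"] by simp

lemma prod_primes_dvd_iff:
  assumes "finite D" "\<And>p. p \<in> D \<Longrightarrow> prime p" "k > (0::nat)"
  shows "\<Prod>D dvd k \<longleftrightarrow> D \<subseteq> prime_factors k"
proof
  assume *: "\<Prod>D dvd k"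
  show "D \<subseteq> prime_factors k"
  proof
    fix p assume p: "p \<in> D"
    then have "p dvd \<Prod>D" using assms by (metis dvd_prod_eqI)
    then show "p \<in> prime_factors k"
      using * assms p by (auto simp: in_prime_factors_iff dest: dvd_trans)
  qed
next
  assume *: "D \<subseteq> prime_factors k"
  have "(\<Prod>p\<in>D. p) dvd (\<Prod>p\<in>prime_factors k. p ^ multiplicity p k)"
  proof (intro prod_dvd_prod_subset2 *)
    fix p assume "p \<in> D"
    then show "p dvd p ^ multiplicity p k" using * by (intro dvd_power) (auto simp: prime_factors_multiplicity)
  qed auto
  then show "\<Prod>D dvd k" using prime_factorization_nat[OF assms(3)] by simp
qed

lemma prime_factors_prod_primes:
  assumes "finite D" "\<And>p. p \<in> D \<Longrightarrow> prime (p::nat)"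
  shows "prime_factors (\<Prod>D) \<subseteq> D"
proof
  fix q assume "q \<in> prime_factors (\<Prod>D)"
  then have "prime q" "q dvd \<Prod>D" by auto
  then obtain p where "p \<in> D" "q dvd p" using assms prime_dvd_prod_iff[of D q "\<lambda>p. p"] by auto
  then show "q \<in> D" using assms primes_dvd_imp_eq[OF \<open>prime q\<close>] by blast
qed

text \<open>An incomplete divisor sum has no reliable cancellation; absolute values give (1 +
  1/2)^card, and 9/4 is the square of 3/2.\<close>

lemma sum_truncated_squared_le:
  fixes P :: "nat set"
  assumes "finite A" "F \<subseteq> Pow A"
  shows "(\<Sum>D\<in>F. (-1/2) ^ card D)\<^sup>2 \<le> (9/4 :: real) ^ card A"
proof -
  have "\<bar>\<Sum>D\<in>F. (-1/2 :: real) ^ card D\<bar> \<le> (\<Sum>D\<in>F. \<bar>(-1/2) ^ card D\<bar>)"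
    by (rule sum_abs)
  also have "\<dots> \<le> (\<Sum>D\<in>Pow A. (1/2) ^ card D)"
    using assms by (simp add: power_abs) (intro sum_mono2, auto)
  also have "\<dots> = (3/2) ^ card A" using sum_Pow_power_card[OF assms(1), of "1/2"] by simp
  finally have "\<bar>\<Sum>D\<in>F. (-1/2 :: real) ^ card D\<bar>\<^sup>2 \<le> ((3/2) ^ card A)\<^sup>2" by (intro power_mono) auto
  also have "((3/2 :: real) ^ card A)\<^sup>2 = ((3/2)\<^sup>2) ^ card A" by (simp add: power_mult[symmetric] mult.commute)
  finally show ?thesis by (simp add: power2_eq_square)
qed

definition piece :: "nat set \<Rightarrow> real \<Rightarrow> complex" where
  "piece S t = (\<Sum>n\<in>S. of_real (real n powr (-1/2)) * chi n t)"

definition fiber :: "nat set \<Rightarrow> nat set \<Rightarrow> nat \<Rightarrow> nat set" where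
  "fiber P M N = {n \<in> {1..N}. prime_part (-P) n \<in> M}"

text \<open>The share of a smooth part s in the mean square: 4^(-omega) from complete divisor sums,
  and (9/4)^omega from truncated ones. The latter occur only for ln s > E, because the rough part m
  satisfies ln m + E \<le> ln N.\<close>

definition tail_weight :: "real \<Rightarrow> nat \<Rightarrow> real" where
  "tail_weight E s = (1/4) ^ omega s / real s + (if ln (real s) > E then (9/4) ^ omega s / real s else 0)"

text \<open>The coefficient of $k$ in $f_S H$ is $k^{-1/2} 2^{-\omega}$ with $\omega$ counting the
  primes in $P$ dividing $k$, as long as $k \le N$; beyond $N$ only the trivial bound is available.\<close>

lemma mean_bdd_piece_weight:
  fixes P M :: "nat set"
  assumes P: "finite P" "\<And>p. p \<in> P \<Longrightarrow> prime p"
    and M: "finite M" "0 \<notin> M" "\<And>m. m \<in> M \<Longrightarrow> ln (real m) + E \<le> ln (real N)"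
    and N: "N > 0"
  obtains A where "finite A" "0 \<notin> A" "\<And>s. s \<in> A \<Longrightarrow> prime_factors s \<subseteq> P"
    "mean_bdd (\<lambda>t. (cmod (piece (fiber P M N) t * weight P t))\<^sup>2)
       ((\<Sum>s\<in>A. tail_weight E s) * (\<Sum>m\<in>M. 1 / real m))"
proof -
  let ?S = "fiber P M N"
  define I where "I = ?S \<times> Pow P"
  define k where "k = (\<lambda>(n, D). n * \<Prod>D :: nat)"
  define c where "c = (\<lambda>(n, D :: nat set). real n powr (-1/2) * ((-1/2) ^ card D * real (\<Prod>D) powr (-1/2)))"
  define K where "K = k ` I"
  define b where "b = (\<lambda>x. \<Sum>i | i \<in> I \<and> k i = x. c i)"
  define A where "A = prime_part P ` K"
  have finS: "finite ?S" by (simp add: fiber_def)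
  have finI: "finite I" using P finS by (simp add: I_def)
  have prodpos: "\<Prod>D > 0" if "D \<subseteq> P" for D
    using that P(2) by (intro prod_pos) (metis prime_gt_0_nat subsetD)
  have finD: "finite D" if "D \<subseteq> P" for D using that P(1) finite_subset by blast
  have kpos: "k i > 0" if "i \<in> I" for i
    using that prodpos by (auto simp: I_def k_def fiber_def split: prod.splits)
  have Kpos: "x > 0" if "x \<in> K" for x using that kpos by (auto simp: K_def)
  \<comment> \<open>Multiplication by primes in \<open>P\<close> leaves the rough part unchanged, so
    every integer reached still has its rough part in \<open>M\<close>.\<close>
  have partK: "prime_part (-P) x \<in> M" if "x \<in> K" for x
  proof -
    obtain n D where x: "n \<in> ?S" "D \<subseteq> P" "x = n * \<Prod>D" 
    proof -
      obtain i where "i \<in> I" "x = k i" using \<open>x \<in> K\<close> by (auto simp: K_def)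
      then show ?thesis using that by (cases i) (auto simp: I_def k_def)
    qed
    have n: "n > 0" using x by (auto simp: fiber_def)
    have "prime_factors (\<Prod>D) \<subseteq> P"
      using prime_factors_prod_primes[OF finD[OF x(2)]] x(2) P(2) by blast
    then have "prime_part (-P) (\<Prod>D) = 1" by (intro prime_part_rough) auto
    then have "prime_part (-P) x = prime_part (-P) n" using x n prodpos[OF x(2)] by (simp add: prime_part_mult)
    then show ?thesis using x by (simp add: fiber_def)
  qed
  \<comment> \<open>Given x, the pair (n, D) is determined by D, and the rough part puts no
    condition on D. So n \<le> N is the only trace of the truncation; for x \<le> N it is void and
    the sum is (1 - 1/2)^omega.\<close>
  have b_eq: "b x = real x powr (-1/2) *
      (\<Sum>D | D \<subseteq> P \<inter> prime_factors x \<and> x div \<Prod>D \<le> N. (-1/2) ^ card D)" if x: "x \<in> K" for x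
  proof -
    have "b x = (\<Sum>i | i \<in> I \<and> k i = x. real x powr (-1/2) * (-1/2) ^ card (snd i))"
      unfolding b_def c_def k_def by (intro sum.cong refl) (auto simp: powr_mult split: prod.splits)
    also have "\<dots> = (\<Sum>D | D \<subseteq> P \<inter> prime_factors x \<and> x div \<Prod>D \<le> N. real x powr (-1/2) * (-1/2) ^ card D)"
    proof (rule sum.reindex_bij_witness[of _ "\<lambda>D. (x div \<Prod>D, D)" snd])
      fix i assume i: "i \<in> {i \<in> I. k i = x}"
      then obtain n D where nD: "i = (n, D)" "n \<in> ?S" "D \<subseteq> P" "n * \<Prod>D = x"
        by (auto simp: I_def k_def)
      have d: "x div \<Prod>D = n" using nD(4) prodpos[OF nD(3)] by auto
      then show "(x div \<Prod>(snd i), snd i) = i" using nD by simp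
      have "\<Prod>D dvd x" using nD(4) by auto
      then have "D \<subseteq> prime_factors x"
        using prod_primes_dvd_iff[OF finD[OF nD(3)] _ Kpos[OF x]] P(2) nD(3) by blast
      then show "snd i \<in> {D. D \<subseteq> P \<inter> prime_factors x \<and> x div \<Prod>D \<le> N}"
        using nD d by (auto simp: fiber_def)
    next
      fix D assume D: "D \<in> {D. D \<subseteq> P \<inter> prime_factors x \<and> x div \<Prod>D \<le> N}"
      then have DP: "D \<subseteq> P" by blast
      have "\<Prod>D dvd x"
        using prod_primes_dvd_iff[OF finD[OF DP] _ Kpos[OF x]] P(2) D by blast
      then have e: "x div \<Prod>D * \<Prod>D = x" by simp
      then have n: "x div \<Prod>D > 0" using Kpos[OF x] by (metis mult_0 neq0_conv)
      have "prime_factors (\<Prod>D) \<subseteq> P"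
        using prime_factors_prod_primes[OF finD[OF DP]] DP P(2) by blast
      then have "prime_part (-P) (\<Prod>D) = 1" by (intro prime_part_rough) auto
      then have "prime_part (-P) (x div \<Prod>D) = prime_part (-P) x"
        using prime_part_mult[OF n prodpos[OF DP], of "-P"] e by simp
      then have "x div \<Prod>D \<in> ?S" using partK[OF x] D n by (auto simp: fiber_def)
      then show "(x div \<Prod>D, D) \<in> {i \<in> I. k i = x}" using DP e by (simp add: I_def k_def)
    qed auto
    finally show ?thesis by (simp add: sum_distrib_left)
  qed
  have b_le: "(b x)\<^sup>2 \<le> tail_weight E (prime_part P x) * (1 / real (prime_part (-P) x))" if x: "x \<in> K" for x
  proof -
    define s m where "s = prime_part P x" and "m = prime_part (-P) x"
    have sm: "s * m = x" "s > 0" "m > 0" using prime_part_mult_compl[OF Kpos[OF x], of P] by (auto simp: s_def m_def)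
    have cardA: "card (P \<inter> prime_factors x) = omega s"
      using Kpos[OF x] by (simp add: s_def omega_def prime_factors_prime_part Int_commute)
    let ?F = "{D. D \<subseteq> P \<inter> prime_factors x \<and> x div \<Prod>D \<le> N}"
    have "(real x powr (-1/2))\<^sup>2 = 1 / real x"
      using Kpos[OF x] by (simp add: powr_power powr_minus field_simps)
    then have bx: "(b x)\<^sup>2 = (\<Sum>D\<in>?F. (-1/2) ^ card D)\<^sup>2 / (real s * real m)"
      using sm(1) by (simp add: b_eq[OF x] power_mult_distrib flip: of_nat_mult)
    have "(\<Sum>D\<in>?F. (-1/2 :: real) ^ card D)\<^sup>2 \<le> (1/4) ^ omega s + (if ln (real s) > E then (9/4) ^ omega s else 0)"
    proof (cases "x \<le> N")
      case True
      have "?F = Pow (P \<inter> prime_factors x)"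
        using True by (auto intro: order_trans[OF div_le_dividend])
      then have "(\<Sum>D\<in>?F. (-1/2 :: real) ^ card D) = (1/2) ^ omega s"
        using sum_Pow_power_card[of "P \<inter> prime_factors x" "-1/2"] P(1) cardA by simp
      then have "(\<Sum>D\<in>?F. (-1/2 :: real) ^ card D)\<^sup>2 = (1/4) ^ omega s"
        by (simp add: power2_eq_square power_mult_distrib[symmetric])
      then show ?thesis by simp
    next
      case False
      \<comment> \<open>Beyond N, the margin \<open>E\<close> imposed on \<open>M\<close> forces the
        smooth part to be large.\<close>
      have "ln (real N) < ln (real x)" using False N by (subst ln_less_cancel_iff) auto
      also have "ln (real x) = ln (real s) + ln (real m)" using sm by (simp add: ln_mult flip: sm(1))
      finally have "ln (real s) > E" using M(3)[OF partK[OF x]] by (simp add: m_def)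
      moreover have "(\<Sum>D\<in>?F. (-1/2 :: real) ^ card D)\<^sup>2 \<le> (9/4) ^ card (P \<inter> prime_factors x)"
        using P(1) by (intro sum_truncated_squared_le) auto
      ultimately show ?thesis using cardA by (simp add: add_increasing)
    qed
    then have "(b x)\<^sup>2 \<le> ((1/4) ^ omega s + (if ln (real s) > E then (9/4) ^ omega s else 0)) / (real s * real m)"
      unfolding bx by (rule divide_right_mono) simp
    also have "\<dots> = tail_weight E s * (1 / real m)"
      by (simp add: tail_weight_def add_divide_distrib)
    finally show ?thesis by (simp add: s_def m_def)
  qed
  have finK: "finite K" and K0: "0 \<notin> K" using finI Kpos by (auto simp: K_def)
  show ?thesis
  proof (rule that[of A])
    show "finite A" using finK by (simp add: A_def)
    show "0 \<notin> A" unfolding A_def by (metis imageE less_irrefl prime_part_pos)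
    show "prime_factors s \<subseteq> P" if "s \<in> A" for s
      using that Kpos by (auto simp: A_def prime_factors_prime_part)
    have "piece ?S t * weight P t = dpoly K b t" for t
    proof -
      have H: "weight P t = (\<Sum>D\<in>Pow P. of_real ((-1/2) ^ card D * real (\<Prod>D) powr (-1/2)) * chi (\<Prod>D) t)"
        using P by (rule weight_expand)
      have "piece ?S t * weight P t = (\<Sum>i\<in>I. (of_real (real (fst i) powr (-1/2)) * chi (fst i) t) *
             (of_real ((-1/2) ^ card (snd i) * real (\<Prod>(snd i)) powr (-1/2)) * chi (\<Prod>(snd i)) t))"
        unfolding piece_def H sum_product sum.cartesian_product I_def case_prod_unfold ..
      also have "\<dots> = (\<Sum>i\<in>I. of_real (c i) * chi (k i) t)"
      proof (intro sum.cong refl)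
        fix i assume "i \<in> I"
        then obtain n D where i: "i = (n, D)" "n \<in> ?S" "D \<subseteq> P" unfolding I_def by blast
        then have "n > 0" by (auto simp: fiber_def)
        then show "(of_real (real (fst i) powr (-1/2)) * chi (fst i) t) *
             (of_real ((-1/2) ^ card (snd i) * real (\<Prod>(snd i)) powr (-1/2)) * chi (\<Prod>(snd i)) t) = of_real (c i) * chi (k i) t"
          using i prodpos[OF i(3)] by (simp add: c_def k_def chi_mult del: of_nat_prod)
      qed
      also have "\<dots> = dpoly K b t"
        unfolding K_def b_def by (intro dpoly_reindex finI kpos)
      finally show ?thesis .
    qed
    moreover have "has_mean (\<lambda>t. (cmod (dpoly K b t))\<^sup>2) (\<Sum>x\<in>K. (b x)\<^sup>2)"
      by (intro has_mean_dpoly finK K0)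
    moreover have "(\<Sum>x\<in>K. (b x)\<^sup>2) \<le> (\<Sum>s\<in>A. tail_weight E s) * (\<Sum>m\<in>M. 1 / real m)"
    proof -
      have "(\<Sum>x\<in>K. (b x)\<^sup>2) \<le> (\<Sum>x\<in>K. tail_weight E (prime_part P x) * (1 / real (prime_part (-P) x)))"
        by (intro sum_mono b_le)
      also have "\<dots> \<le> (\<Sum>s\<in>A. tail_weight E s) * (\<Sum>m\<in>M. 1 / real m)"
        using K0 finK M(1) partK by (intro sum_prime_part_le) (auto simp: A_def tail_weight_def)
      finally show ?thesis .
    qed
    ultimately show "mean_bdd (\<lambda>t. (cmod (piece ?S t * weight P t))\<^sup>2)
       ((\<Sum>s\<in>A. tail_weight E s) * (\<Sum>m\<in>M. 1 / real m))"
      by (simp add: has_mean_imp_mean_bdd)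
  qed
qed

section \<open>Rankin's trick for the coefficients beyond N\<close>

text \<open>For p \<le> e^Z the shift costs p^(1/Z) \<le> e < 3, so y = p^(1 - 1/Z) is at least p/3.
  As y \<ge> sqrt 2 \<ge> 7/5 too, subtracting 1 leaves at least 2y/7 \<ge> 2p/21.\<close>

lemma small_primes_powr_ge:
  assumes Z: "Z \<ge> 2" and p: "p \<in> small_primes Z"
  shows "real p powr (1 - 1 / Z) - 1 \<ge> real p / 11"
proof -
  have p2: "real p \<ge> 2" using prime_ge_2_nat[OF prime_small_primes[OF p]] by simp
  have lnp: "ln (real p) / Z \<le> 1" using p Z by (simp add: small_primes_def)
  let ?y = "real p powr (1 - 1 / Z)"
  have "2 powr (1/2) \<le> (2::real) powr (1 - 1 / Z)" using Z by (intro powr_mono) (auto simp: field_simps)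
  also have "\<dots> \<le> ?y" using p2 Z by (intro powr_mono2) auto
  finally have "sqrt 2 \<le> ?y" by (simp add: powr_half_sqrt)
  moreover have "7/5 \<le> sqrt (2::real)" by (rule real_le_rsqrt) (simp add: power2_eq_square)
  ultimately have y: "?y \<ge> 7/5" by linarith
  have "?y = real p * exp (- (ln (real p) / Z))"
    using p2 by (simp add: powr_def left_diff_distrib exp_diff exp_minus field_simps)
  also have "\<dots> \<ge> real p * exp (-1)" using lnp by (intro mult_left_mono) auto
  finally have "?y \<ge> real p * exp (-1)" .
  moreover have "exp (-1) \<ge> (1/3 :: real)" using exp_le by (simp add: exp_minus field_simps)
  then have "real p * exp (-1) \<ge> real p * (1/3)" by (intro mult_left_mono) auto
  ultimately have "?y \<ge> real p / 3" by simp
  then show ?thesis using y by linarith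
qed

text \<open>The first part of \<open>tail_weight\<close> is bounded by an Euler product of order
  Z^(1/4). In the second the condition ln s > E is relaxed to the factor e^(-E/Z) s^(1/Z) \<ge> 1,
  and the shifted Euler product is at most of order Z^25.\<close>

lemma sum_tail_weight_le:
  assumes Z: "Z \<ge> 2" and A: "finite A" "0 \<notin> A" "\<And>s. s \<in> A \<Longrightarrow> prime_factors s \<subseteq> small_primes Z"
    and E: "exp (- E / Z) * Z ^ 25 \<le> 1"
  shows "(\<Sum>s\<in>A. tail_weight E s) \<le> 2 * exp 200 * Z powr (1/4)"
proof -
  have pos: "s > 0" if "s \<in> A" for s using that A by (auto intro!: Nat.gr0I)
  have Zp: "1 \<le> Z powr (1/4)" using Z by (intro ge_one_powr_ge_zero) auto
  have "(\<Sum>s\<in>A. (1/4) ^ omega s / real s) \<le> exp 200 * Z powr (1/4)"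
  proof -
    have "(\<Sum>s\<in>A. (1/4) ^ omega s / real s) = (\<Sum>s\<in>A. (1/4) ^ omega s * real s powr (-1))"
      by (simp add: powr_minus field_simps)
    also have "\<dots> \<le> (\<Prod>p\<in>small_primes Z. 1 + (1/4) / (real p powr 1 - 1))"
      using A by (intro sum_smooth_le) (auto simp: prime_small_primes)
    also have "\<dots> \<le> exp (1/4 * ((\<Sum>p\<in>small_primes Z. 1 / real p) + 1))"
      using prod_one_plus_le[of "small_primes Z" "1/4"] by (simp add: prime_ge_2_nat prime_small_primes)
    also have "\<dots> \<le> exp (200 + 1/4 * ln Z)"
      using sum_inverse_small_primes_le[of Z] Z by simp
    also have "\<dots> = exp 200 * Z powr (1/4)" using Z by (simp add: exp_add powr_def)
    finally show ?thesis .
  qed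
  moreover have "(\<Sum>s\<in>A. if ln (real s) > E then (9/4) ^ omega s / real s else 0) \<le> exp 200 * Z powr (1/4)"
  proof -
    have "(\<Sum>s\<in>A. if ln (real s) > E then (9/4) ^ omega s / real s else 0) \<le>
        (\<Sum>s\<in>A. exp (- E / Z) * ((9/4) ^ omega s * real s powr (-(1 - 1 / Z))))"
    proof (intro sum_mono)
      fix s assume s: "s \<in> A"
      have sp: "real s > 0" using pos[OF s] by simp
      show "(if ln (real s) > E then (9/4) ^ omega s / real s else 0) \<le>
          exp (- E / Z) * ((9/4) ^ omega s * real s powr (-(1 - 1 / Z)))"
      proof (cases "ln (real s) > E")
        case True
        have "real s powr (-(1 - 1 / Z)) = exp (ln (real s) / Z) / real s"
          using sp by (simp add: powr_def left_diff_distrib exp_diff field_simps)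
        moreover have "exp (ln (real s) / Z) \<ge> exp (E / Z)" using True Z by (simp add: divide_right_mono)
        then have "exp (- E / Z) * exp (ln (real s) / Z) \<ge> exp (- E / Z) * exp (E / Z)"
          by (intro mult_left_mono) auto
        then have "exp (- E / Z) * exp (ln (real s) / Z) \<ge> 1" by (simp add: exp_minus)
        then have "(exp (- E / Z) * exp (ln (real s) / Z)) * ((9/4) ^ omega s / real s) \<ge> 1 * ((9/4) ^ omega s / real s)"
          by (rule mult_right_mono) simp
        ultimately show ?thesis using True by (simp add: mult_ac)
      qed simp
    qed
    also have "\<dots> = exp (- E / Z) * (\<Sum>s\<in>A. (9/4) ^ omega s * real s powr (-(1 - 1 / Z)))"
      by (simp add: sum_distrib_left)
    also have "\<dots> \<le> exp (- E / Z) * (exp 200 * Z ^ 25)"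
    proof (intro mult_left_mono)
      have "(\<Sum>s\<in>A. (9/4) ^ omega s * real s powr (-(1 - 1 / Z))) \<le>
          (\<Prod>p\<in>small_primes Z. 1 + (9/4) / (real p powr (1 - 1 / Z) - 1))"
        using A Z by (intro sum_smooth_le) (auto simp: prime_small_primes)
      also have "\<dots> \<le> (\<Prod>p\<in>small_primes Z. exp (25 * (1 / real p)))"
      proof (intro prod_mono conjI)
        fix p assume p: "p \<in> small_primes Z"
        have p2: "real p \<ge> 2" using prime_ge_2_nat[OF prime_small_primes[OF p]] by simp
        have d: "real p powr (1 - 1 / Z) - 1 \<ge> real p / 11" by (rule small_primes_powr_ge[OF Z p])
        then have "(9/4) / (real p powr (1 - 1 / Z) - 1) \<le> (9/4) / (real p / 11)"
          using p2 by (intro divide_left_mono mult_pos_pos) auto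
        \<comment> \<open>11 times 9/4 is 24.75: the source of the 25 in all scales.\<close>
        also have "\<dots> \<le> 25 * (1 / real p)" using p2 by (simp add: field_simps)
        finally show "1 + (9/4) / (real p powr (1 - 1 / Z) - 1) \<le> exp (25 * (1 / real p))"
          using exp_ge_add_one_self[of "25 * (1 / real p)"] by linarith
        have "real p powr (1 - 1 / Z) - 1 > 0" using d p2 by linarith
        then show "0 \<le> 1 + (9/4) / (real p powr (1 - 1 / Z) - 1)" by simp
      qed
      also have "\<dots> = exp (25 * (\<Sum>p\<in>small_primes Z. 1 / real p))"
        by (simp add: exp_sum[symmetric] sum_distrib_left)
      also have "\<dots> \<le> exp (200 + real 25 * ln Z)"
        using sum_inverse_small_primes_le[of Z] Z by simp
      also have "\<dots> = exp 200 * Z ^ 25"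
        using Z by (simp only: exp_add exp_of_nat_mult) simp
      finally show "(\<Sum>s\<in>A. (9/4) ^ omega s * real s powr (-(1 - 1 / Z))) \<le> exp 200 * Z ^ 25" .
    qed simp
    also have "\<dots> = exp 200 * (exp (- E / Z) * Z ^ 25)" by simp
    also have "\<dots> \<le> exp 200 * Z powr (1/4)"
      using E Zp by (intro mult_left_mono) auto
    finally show ?thesis .
  qed
  ultimately show ?thesis by (simp add: tail_weight_def sum.distrib)
qed

text \<open>\<open>K\<close> depends on \<open>q\<close> alone, so the bounds of different scales
  can be summed. The hypothesis on \<open>E\<close> and \<open>Z\<close> is the Rankin
  condition.\<close>

lemma mean_bdd_piece_powr:
  assumes q: "0 < q" "q \<le> 1"
  shows "\<exists>K>0. \<forall>Z E M N W. 2 \<le> Z \<longrightarrow> exp (- E / Z) * Z ^ 25 \<le> 1 \<longrightarrow> N > 0 \<longrightarrow> finite M \<longrightarrow> 0 \<notin> M \<longrightarrow>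
     (\<forall>m\<in>M. ln (real m) + E \<le> ln (real N)) \<longrightarrow> W > 0 \<longrightarrow> (\<Sum>m\<in>M. 1 / real m) \<le> W \<longrightarrow>
     mean_bdd (\<lambda>t. cmod (piece (fiber (small_primes Z) M N) t) powr q)
       (K * W powr (q / 2) * Z powr (q * norm_exponent q))"
proof -
  define \<theta> a where "\<theta> = q / 2" and "a = q / (2 - q)"
  have th: "0 < \<theta>" "\<theta> < 1" using q by (auto simp: \<theta>_def)
  have a: "0 < a" "a \<le> 1" using q by (auto simp: a_def field_simps)
  \<comment> \<open>This relation makes the powers of |H| cancel in Hoelder's inequality and so
    dictates \<open>a\<close>; q \<le> 1 yields a \<le> 1, as the Taylor bound requires.\<close>
  have ath: "a * (1 - \<theta>) = \<theta>" using q by (simp add: a_def \<theta>_def field_simps)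
  obtain D where D: "D > 0" "\<And>a Z. 0 < a \<Longrightarrow> a \<le> 1 \<Longrightarrow> 1 \<le> Z \<Longrightarrow>
     mean_bdd (\<lambda>t. cmod (weight (small_primes Z) t) powr (-2 * a)) (D * Z powr (a\<^sup>2 / 4))"
    using mean_bdd_weight_powr by blast
  define K where "K = (2 * exp 200) powr \<theta> * D powr (1 - \<theta>)"
  have "mean_bdd (\<lambda>t. cmod (piece (fiber (small_primes Z) M N) t) powr q)
       (K * W powr (q / 2) * Z powr (q * norm_exponent q))"
    if Z: "2 \<le> Z" and E: "exp (- E / Z) * Z ^ 25 \<le> 1" and N: "N > 0" and M: "finite M" "0 \<notin> M"
     "\<forall>m\<in>M. ln (real m) + E \<le> ln (real N)" and W: "W > 0" "(\<Sum>m\<in>M. 1 / real m) \<le> W"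
    for Z E M N W
  proof -
    let ?f = "piece (fiber (small_primes Z) M N)" and ?H = "weight (small_primes Z)"
    obtain A where A: "finite A" "0 \<notin> A" "\<And>s. s \<in> A \<Longrightarrow> prime_factors s \<subseteq> small_primes Z"
      "mean_bdd (\<lambda>t. (cmod (?f t * ?H t))\<^sup>2) ((\<Sum>s\<in>A. tail_weight E s) * (\<Sum>m\<in>M. 1 / real m))"
      by (rule mean_bdd_piece_weight[of "small_primes Z" M E N, OF finite_small_primes prime_small_primes[of _ Z] M(1,2) _ N])
         (assumption, use M(3) in blast, rule that)
    have "(\<Sum>s\<in>A. tail_weight E s) * (\<Sum>m\<in>M. 1 / real m) \<le> (2 * exp 200 * Z powr (1/4)) * W"
      using sum_tail_weight_le[OF Z A(1-3) E] W(2)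
      by (intro mult_mono) (auto intro!: sum_nonneg)
    then have X: "mean_bdd (\<lambda>t. (cmod (?f t * ?H t))\<^sup>2) ((2 * exp 200 * Z powr (1/4)) * W)"
      by (intro mean_bdd_mono[OF A(4)]) auto
    have Y: "mean_bdd (\<lambda>t. cmod (?H t) powr (-2 * a)) (D * Z powr (a\<^sup>2 / 4))"
      using D(2)[OF a] Z by simp
    have "mean_bdd (\<lambda>t. cmod (?f t) powr q)
        (((2 * exp 200 * Z powr (1/4)) * W) powr \<theta> * (D * Z powr (a\<^sup>2 / 4)) powr (1 - \<theta>))"
    proof (rule mean_bdd_Hoelder[OF X Y _ _ th])
      show "2 * exp 200 * Z powr (1/4) * W > 0" "D * Z powr (a\<^sup>2 / 4) > 0" using Z W D by auto
      fix t
      have H: "cmod (?H t) > 0" using weight_nonzero[OF finite_small_primes prime_small_primes] by simp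
      have "((cmod (?f t * ?H t))\<^sup>2) powr \<theta> = cmod (?f t * ?H t) powr q"
        using powr_powr[of "cmod (?f t * ?H t)" 2 \<theta>] by (simp add: \<theta>_def)
      also have "\<dots> = cmod (?f t) powr q * cmod (?H t) powr q" by (simp add: norm_mult powr_mult)
      finally have "((cmod (?f t * ?H t))\<^sup>2) powr \<theta> * (cmod (?H t) powr (-2 * a)) powr (1 - \<theta>) =
          cmod (?f t) powr q * (cmod (?H t) powr q * cmod (?H t) powr (-2 * a * (1 - \<theta>)))"
        by (simp add: powr_powr)
      also have "-2 * a * (1 - \<theta>) = - q" using ath by (simp add: \<theta>_def)
      also have "cmod (?H t) powr q * cmod (?H t) powr (- q) = 1" using H by (simp add: powr_minus)
      finally show "cmod (?f t) powr q \<le>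
        ((cmod (?f t * ?H t))\<^sup>2) powr \<theta> * (cmod (?H t) powr (-2 * a)) powr (1 - \<theta>)" by simp
    qed auto
    moreover have "((2 * exp 200 * Z powr (1/4)) * W) powr \<theta> * (D * Z powr (a\<^sup>2 / 4)) powr (1 - \<theta>) =
        K * W powr \<theta> * (Z powr (1/4 * \<theta>) * Z powr (a\<^sup>2 / 4 * (1 - \<theta>)))"
      using Z W D by (simp add: K_def powr_mult powr_powr mult_ac)
    moreover have "Z powr (1/4 * \<theta>) * Z powr (a\<^sup>2 / 4 * (1 - \<theta>)) = Z powr (q * norm_exponent q)"
    proof -
      have "1/4 * \<theta> + a\<^sup>2 / 4 * (1 - \<theta>) = \<theta> / 4 * (1 + a)"
      proof -
        have "a\<^sup>2 / 4 * (1 - \<theta>) = a / 4 * (a * (1 - \<theta>))" by (simp add: power2_eq_square)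
        also have "\<dots> = a / 4 * \<theta>" by (simp only: ath)
        finally show ?thesis by (simp add: algebra_simps)
      qed
      also have "\<dots> = q * norm_exponent q"
        using q by (simp add: \<theta>_def a_def norm_exponent_def field_simps)
      finally show ?thesis by (simp add: powr_add[symmetric])
    qed
    ultimately show ?thesis by (simp add: \<theta>_def)
  qed
  moreover have "K > 0" using D by (simp add: K_def)
  ultimately show ?thesis by blast
qed

section \<open>Decomposition into scales\<close>

text \<open>Homogeneity reduces this to x + y = 1, where u \<le> u^q for 0 \<le> u \<le> 1. It
  stands in for Minkowski's inequality, which fails for q < 1.\<close>

lemma powr_add_le:
  fixes x y :: real
  assumes "0 \<le> x" "0 \<le> y" "0 < q" "q \<le> 1"
  shows "(x + y) powr q \<le> x powr q + y powr q"
proof (cases "x + y = 0")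
  case False
  then have s: "x + y > 0" using assms by linarith
  have *: "u / (x + y) \<le> (u / (x + y)) powr q" if "0 \<le> u" "u \<le> x + y" for u
    using powr_mono'[of q 1 "u / (x + y)"] that s assms by (simp add: divide_le_eq_1)
  have "1 = x / (x + y) + y / (x + y)" using s by (simp add: add_divide_distrib[symmetric])
  also have "\<dots> \<le> (x / (x + y)) powr q + (y / (x + y)) powr q"
    using assms by (intro add_mono *) auto
  also have "\<dots> = (x powr q + y powr q) / (x + y) powr q"
    using assms s by (simp only: powr_divide add_divide_distrib)
  finally show ?thesis using s by (simp add: le_divide_eq)
qed (use assms in auto)

lemma powr_norm_sum_le:
  fixes f :: "'a \<Rightarrow> complex"
  assumes "finite I" "0 < q" "q \<le> 1"
  shows "cmod (\<Sum>i\<in>I. f i) powr q \<le> (\<Sum>i\<in>I. cmod (f i) powr q)"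
  using assms(1)
proof (induction rule: finite_induct)
  case (insert i I)
  have "cmod (f i + (\<Sum>i\<in>I. f i)) powr q \<le> (cmod (f i) + cmod (\<Sum>i\<in>I. f i)) powr q"
    using assms by (intro powr_mono2 norm_triangle_ineq) auto
  also have "\<dots> \<le> cmod (f i) powr q + cmod (\<Sum>i\<in>I. f i) powr q"
    using assms by (intro powr_add_le) auto
  finally show ?case using insert by simp
qed simp

lemma zeta_half_poly_eq_piece: "zeta_half_poly N (\<i> * of_real t) = piece {1..N} t"
  unfolding zeta_half_poly_def piece_def
proof (intro sum.cong refl)
  fix n assume "n \<in> {1..N}"
  then have n: "n > 0" by simp
  have "of_nat n powr (1 / 2 + \<i> * of_real t) = exp ((1 / 2 + \<i> * of_real t) * of_real (ln (real n)))"
    using n by (simp add: powr_def Ln_of_nat)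
  then have "1 / of_nat n powr (1 / 2 + \<i> * of_real t) =
      exp (- ((1 / 2 + \<i> * of_real t) * of_real (ln (real n))))"
    by (simp add: exp_minus inverse_eq_divide)
  also have "- ((1 / 2 + \<i> * of_real t) * of_real (ln (real n))) =
      of_real (- 1 / 2 * ln (real n)) + \<i> * of_real (- (t * ln (real n)))"
    by (simp add: algebra_simps)
  also have "exp \<dots> = of_real (exp (- 1 / 2 * ln (real n))) * cis (- (t * ln (real n)))"
    by (simp only: exp_add cis_conv_exp exp_of_real)
  also have "exp (- 1 / 2 * ln (real n)) = real n powr (- 1 / 2)" using n by (simp add: powr_def)
  finally show "1 / of_nat n powr (1 / 2 + \<i> * of_real t) = of_real (real n powr (- 1 / 2)) * chi n t"
    by (simp add: chi_def)
qed

text \<open>Existence of the mean is essential here: \<open>Lim\<close> is a definite description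
  and carries information only when the limit exists.\<close>

lemma dirichlet_norm_le:
  assumes q: "q > 0" and B: "mean_bdd (\<lambda>t. cmod (piece {1..N} t) powr q) B"
  shows "dirichlet_norm q (zeta_half_poly N) \<le> B powr (1 / q)"
proof -
  have "is_dpoly (piece {1..N})"
    unfolding is_dpoly_def
    by (intro exI[of _ "{1..N}"] exI[of _ "\<lambda>n. real n powr (-1/2)"]) (auto simp: piece_def dpoly_def)
  then obtain l where l: "has_mean (\<lambda>t. cmod (piece {1..N} t) powr q) l"
    using has_mean_powr[OF _ q] by blast
  have "l \<ge> 0" using has_mean_le[OF has_mean_const[of 0] l] by simp
  moreover have "l \<le> B" using mean_bdd_le[OF l B] .
  moreover have "Lim at_top (\<lambda>T. 1 / T * integral {0..T} (\<lambda>t. cmod (piece {1..N} t) powr q)) = l"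
    using l unfolding has_mean_def by (intro tendsto_Lim) auto
  ultimately show ?thesis
    using q unfolding dirichlet_norm_def zeta_half_poly_eq_piece by (auto intro!: powr_mono2)
qed

text \<open>Each n in \<open>S\<close> splits into a smooth part, controlled by \<open>V\<close>,
  and a rough part confined to (e^(Y-E), e^Y], where the window bound applies.\<close>

lemma sum_inverse_window_smooth_le:
  assumes Z: "2 \<le> Z" "Z \<le> Y" and E: "0 \<le> E" "E \<le> Y / 2"
    and S: "finite S" "0 \<notin> S"
      "\<And>n. n \<in> S \<Longrightarrow> ln (real n) \<le> Y \<and> Y < ln (real (prime_part (- small_primes Z) n)) + E"
    and V: "\<And>A. A = prime_part (small_primes Z) ` S \<Longrightarrow> (\<Sum>a\<in>A. 1 / real a) \<le> V"
  shows "(\<Sum>n\<in>S. 1 / real n) \<le> V * (2 * exp 10 * ((E + 6) / Z))"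
proof -
  have pos: "n > 0" if "n \<in> S" for n using that S by (auto intro!: Nat.gr0I)
  let ?A = "prime_part (small_primes Z) ` S" and ?B = "prime_part (- small_primes Z) ` S"
  have "(\<Sum>n\<in>S. 1 / real n) = (\<Sum>n\<in>S. 1 / real (prime_part (small_primes Z) n) * (1 / real (prime_part (- small_primes Z) n)))"
  proof (intro sum.cong refl)
    fix n assume "n \<in> S"
    then have "real n = real (prime_part (small_primes Z) n) * real (prime_part (- small_primes Z) n)"
      using prime_part_mult_compl[OF pos] by (metis of_nat_mult)
    then show "1 / real n = 1 / real (prime_part (small_primes Z) n) * (1 / real (prime_part (- small_primes Z) n))" by simp
  qed
  also have "\<dots> \<le> (\<Sum>a\<in>?A. 1 / real a) * (\<Sum>b\<in>?B. 1 / real b)"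
    using S by (intro sum_prime_part_le) auto
  also have "\<dots> \<le> V * (2 * exp 10 * ((E + 6) / Z))"
  proof (intro mult_mono)
    show A: "(\<Sum>a\<in>?A. 1 / real a) \<le> V" using V by simp
    show "0 \<le> V" by (rule order_trans[OF _ A]) (auto intro!: sum_nonneg)
    show "(\<Sum>b\<in>?B. 1 / real b) \<le> 2 * exp 10 * ((E + 6) / Z)"
    proof (rule sum_inverse_rough_window_le)
      fix b assume "b \<in> ?B"
      then obtain n where n: "n \<in> S" "b = prime_part (- small_primes Z) n" by auto
      show "prime_factors b \<inter> small_primes Z = {}" using n pos by (auto simp: prime_factors_prime_part)
      have "b \<le> n"
        using prime_part_mult_compl[OF pos[OF n(1)], of "- small_primes Z"] prime_part_pos[of "small_primes Z" n] n(2)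
        by (metis double_complement le_add2 mult.commute mult_le_mono1 mult_1 Suc_leI One_nat_def)
      then have "ln (real b) \<le> ln (real n)" using n by (subst ln_le_cancel_iff) (auto simp: pos)
      then show "Y - E < ln (real b) \<and> ln (real b) \<le> Y" using S(3)[OF n(1)] n(2) by auto
    next
      show "0 \<notin> ?B" by (metis imageE less_irrefl prime_part_pos)
    qed (use Z E S in auto)
  qed (auto intro!: sum_nonneg)
  finally show ?thesis .
qed

text \<open>The last two conditions on \<open>N\<close> say that log log N \<ge> 1 and that the
  largest scale \<open>Z 0\<close> is at least 2.\<close>

lemma mean_bdd_zeta_half_poly:
  assumes q: "0 < q" "q \<le> 1"
  shows "\<exists>K>0. \<forall>N. N > 0 \<longrightarrow> ln (ln (real N)) \<ge> 1 \<longrightarrow> ln (real N) / (50 * ln (ln (real N))) \<ge> 2 \<longrightarrow>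
     mean_bdd (\<lambda>t. cmod (piece {1..N} t) powr q)
       (K * ln (ln (real N)) powr (q / 2) * (ln (real N) / ln (ln (real N))) powr (q * norm_exponent q))"
proof -
  define \<beta> where "\<beta> = q * norm_exponent q"
  have beta: "\<beta> > 0" using q by (simp add: \<beta>_def norm_exponent_def)
  obtain K where K: "K > 0" "\<And>Z E M N W. 2 \<le> Z \<Longrightarrow> exp (- E / Z) * Z ^ 25 \<le> 1 \<Longrightarrow> N > 0 \<Longrightarrow> finite M \<Longrightarrow> 0 \<notin> M \<Longrightarrow>
     (\<forall>m\<in>M. ln (real m) + E \<le> ln (real N)) \<Longrightarrow> W > 0 \<Longrightarrow> (\<Sum>m\<in>M. 1 / real m) \<le> W \<Longrightarrow>
     mean_bdd (\<lambda>t. cmod (piece (fiber (small_primes Z) M N) t) powr q) (K * W powr (q / 2) * Z powr \<beta>)"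
    using mean_bdd_piece_powr[OF q] unfolding \<beta>_def by blast
  define x where "x = (1/2 :: real) powr \<beta>"
  have x: "0 < x" "x < 1" using beta by (auto simp: x_def powr01_less_one)
  \<comment> \<open>A factor 2 e^10 for the primes between neighbouring scales, times 56 e^10 for
    the window.\<close>
  define c :: real where "c = 112 * exp 20"
  define K' where "K' = (K / (1 - x) + 1) * c powr (q / 2)"
  have "mean_bdd (\<lambda>t. cmod (piece {1..N} t) powr q)
       (K' * ln (ln (real N)) powr (q / 2) * (ln (real N) / ln (ln (real N))) powr \<beta>)"
    if N: "N > 0" and L1: "ln (ln (real N)) \<ge> 1" and YL: "ln (real N) / (50 * ln (ln (real N))) \<ge> 2" for N
  proof -
    define Y L where "Y = ln (real N)" and "L = ln Y"
    have L: "L \<ge> 1" using L1 by (simp add: L_def Y_def)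
    have Y: "Y \<ge> 100 * L" using YL L by (simp add: Y_def L_def field_simps)
    \<comment> \<open>The first margin Y/2 is the largest that the window bound admits. The ratio
      \<open>E j / Z j = 25 * L\<close> yields the Rankin condition, since Z \<le> Y gives Z^25
      \<le> e^(25 L).\<close>
    define E Z where "E = (\<lambda>j::nat. Y / 2 ^ Suc j)" and "Z = (\<lambda>j. E j / (25 * L))"
    have EZ: "E j / Z j = 25 * L" for j
      using L Y by (simp add: Z_def E_def)
    have E0: "0 < E j" "E j \<le> Y / 2" for j
    proof -
      show "0 < E j" using L Y by (simp add: E_def)
      have "Y / 2 / 2 ^ j \<le> Y / 2 / 1" using L Y by (intro divide_left_mono) auto
      then show "E j \<le> Y / 2" by (simp add: E_def field_simps)
    qed
    have ZE: "Z j \<le> E j" for j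
    proof -
      have "E j / (25 * L) \<le> E j / 1" using L E0[of j] by (intro divide_left_mono) auto
      then show ?thesis by (simp add: Z_def)
    qed
    then have ZY: "Z j \<le> Y" for j using E0[of j] L Y order_trans[OF ZE[of j] E0(2)[of j]] by simp
    have ZSuc: "Z (Suc j) = Z j / 2" for j by (simp add: Z_def E_def)
    have Zpow: "Z j = Z 0 * (1/2) ^ j" for j by (induction j) (auto simp: ZSuc)
    have Z0: "Z 0 \<ge> 2" using YL L by (simp add: Z_def E_def Y_def L_def mult_ac)
    have Zmono: "Z j \<le> Z i" if "i \<le> j" for i j
      unfolding Zpow[of i] Zpow[of j] using that Z0 by (intro mult_left_mono power_decreasing) auto
    have "\<exists>j. Z (Suc j) < 2"
    proof -
      obtain n where "(1/2 :: real) ^ n < 2 / Z 0" using real_arch_pow_inv[of "2 / Z 0" "1/2"] Z0 by auto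
      then have "Z n < 2" using Z0 by (simp add: Zpow[of n] field_simps)
      then have "Z (Suc n) < 2" using Zmono[of n "Suc n"] by simp
      then show ?thesis by blast
    qed
    \<comment> \<open>\<open>J\<close> is the last scale with Z \<ge> 2. Testing
      \<open>Suc j\<close> lets J = 0 rest on \<open>Z0\<close>.\<close>
    define J where "J = (LEAST j. Z (Suc j) < 2)"
    have J1: "Z (Suc J) < 2" unfolding J_def by (rule LeastI_ex) fact
    have J2: "Z j \<ge> 2" if "j \<le> J" for j
    proof (cases j)
      case (Suc i)
      then have "i < J" using that by simp
      then have "\<not> Z (Suc i) < 2" unfolding J_def by (rule not_less_Least)
      then show ?thesis using Suc by simp
    qed (use Z0 in simp)
    define ro where "ro = (\<lambda>j. prime_part (- small_primes (Z j)))"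
    define good where "good = (\<lambda>j n. ln (real (ro j n)) + E j \<le> Y)"
    \<comment> \<open>A smaller index means a larger cut-off, so the rough part at i can be read off
      from the one at j. Hence being good at any i \<le> j depends only on the rough part at j,
      which makes class j a \<open>fiber\<close>.\<close>
    have roro: "ro i (ro j n) = ro i n" if "i \<le> j" "n > 0" for i j n
    proof -
      have "- small_primes (Z i) \<inter> - small_primes (Z j) = - small_primes (Z i)"
        using small_primes_mono[OF Zmono[OF that(1)]] by blast
      then show ?thesis unfolding ro_def using that by (simp add: prime_part_prime_part)
    qed
    have rople: "0 < ro j n \<and> ro j n \<le> n" if "n > 0" for j n
    proof -
      have "ro j n * prime_part (small_primes (Z j)) n = n"
        using prime_part_mult_compl[OF that, of "- small_primes (Z j)"] by (simp add: ro_def)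
      then have "ro j n dvd n" by (metis dvd_triv_left)
      then show ?thesis using that by (auto simp: ro_def dest: dvd_imp_le)
    qed
    have lnN: "ln (real n) \<le> Y" if "n \<in> {1..N}" for n
      using that N unfolding Y_def by (subst ln_le_cancel_iff) auto
    define S where "S = (\<lambda>j. {n \<in> {1..N}. good j n \<and> (\<forall>i<j. \<not> good i n)})"
    define M where "M = (\<lambda>j. {m \<in> {1..N}. ro j m = m \<and> good j m \<and> (\<forall>i<j. \<not> good i m)})"
    define R where "R = {n \<in> {1..N}. \<forall>j\<le>J. \<not> good j n}"
    have fib: "fiber (small_primes (Z j)) (M j) N = S j" for j
    proof -
      have "ro j n \<in> M j \<longleftrightarrow> n \<in> S j" if n: "n \<in> {1..N}" for n
      proof -
        have "good i (ro j n) \<longleftrightarrow> good i n" if "i \<le> j" for i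
          using roro[OF that, of n] n by (simp add: good_def)
        moreover have "ro j (ro j n) = ro j n" using roro[of j j n] n by simp
        moreover have "ro j n \<in> {1..N}" using rople[of n j] n by auto
        ultimately show ?thesis using n by (auto simp: M_def S_def)
      qed
      then show ?thesis by (auto simp: fiber_def ro_def S_def)
    qed
    define W where "W = c * L"
    have W: "W > 0" using L by (simp add: W_def c_def)
    have window: "2 * exp 10 * ((E j + 6) / Z j) \<le> 56 * exp 10 * L" if "j \<le> J" for j
    proof -
      have "(E j + 6) / Z j = 25 * L + 6 / Z j" using EZ[of j] by (simp add: add_divide_distrib)
      also have "6 / Z j \<le> 6 / 2" using J2[OF that] by (intro divide_left_mono) auto
      also have "25 * L + 6 / 2 \<le> 28 * L" using L by simp
      finally have "2 * exp 10 * ((E j + 6) / Z j) \<le> 2 * exp 10 * (28 * L)" by (intro mult_left_mono) auto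
      then show ?thesis by simp
    qed
    have e20: "exp 20 = exp 10 * (exp 10 :: real)" by (simp flip: exp_add)
    have MW: "(\<Sum>m\<in>M j. 1 / real m) \<le> W" if "j \<le> J" for j
    proof (cases j)
      case 0
      \<comment> \<open>There is no window at the first scale, but \<open>Z 0\<close> is so large
        that the Mertens product Y / Z 0 = 50 L has the right size.\<close>
      have "(\<Sum>m\<in>M 0. 1 / real m) \<le> exp 10 * (Y / Z 0)"
      proof (rule sum_inverse_rough_le)
        fix m assume m: "m \<in> M 0"
        then have "m > 0" "ro 0 m = m" "m \<in> {1..N}" by (auto simp: M_def)
        then have "prime_factors m \<inter> small_primes (Z 0) = {}"
          using prime_factors_prime_part[of m "- small_primes (Z 0)"] by (auto simp: ro_def)
        moreover have "prime_factors m \<subseteq> small_primes Y"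
          using \<open>m > 0\<close> lnN[OF \<open>m \<in> {1..N}\<close>] by (rule prime_factors_subset_small_primes)
        ultimately show "prime_factors m \<subseteq> small_primes Y - small_primes (Z 0)" by blast
      qed (use Z0 ZY in \<open>auto simp: M_def\<close>)
      also have "Y / Z 0 = 50 * L" using L Y by (simp add: Z_def E_def)
      also have "exp 10 * (50 * L) \<le> W"
      proof -
        have "1 \<le> exp (10::real)" by simp
        then have "exp 10 * 50 * 1 \<le> exp 10 * 112 * exp (10::real)" by (intro mult_mono) auto
        then show ?thesis unfolding W_def c_def e20 using L by simp
      qed
      finally show ?thesis using 0 by simp
    next
      case (Suc i)
      have i: "i \<le> J" using that Suc by simp
      \<comment> \<open>Failure at the preceding scale i puts the rough part at i in a window. The
        other primes lie between \<open>Z j\<close> and \<open>Z i\<close>, which is 2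
        \<open>Z j\<close>, and contribute a bounded factor.\<close>
      have "(\<Sum>m\<in>M j. 1 / real m) \<le> (2 * exp 10) * (2 * exp 10 * ((E i + 6) / Z i))"
      proof (rule sum_inverse_window_smooth_le)
        show "2 \<le> Z i" "Z i \<le> Y" "0 \<le> E i" "E i \<le> Y / 2" using J2[OF i] ZY E0[of i] by auto
        show "ln (real n) \<le> Y \<and> Y < ln (real (prime_part (- small_primes (Z i)) n)) + E i" if "n \<in> M j" for n
          using that lnN[of n] Suc by (auto simp: M_def good_def ro_def not_le)
        fix A assume A: "A = prime_part (small_primes (Z i)) ` M j"
        have "(\<Sum>a\<in>A. 1 / real a) \<le> exp 10 * (Z i / Z j)"
        proof (rule sum_inverse_rough_le)
          show "1 \<le> Z j" "Z j \<le> Z i" using J2[OF that] Zmono[of i j] Suc by auto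
          show "finite A" unfolding A by (simp add: M_def)
          show "0 \<notin> A" unfolding A by (metis imageE less_irrefl prime_part_pos)
          fix a assume "a \<in> A"
          then obtain m where m: "m \<in> M j" "a = prime_part (small_primes (Z i)) m" unfolding A by blast
          then have "m > 0" "ro j m = m" by (auto simp: M_def)
          then have "prime_factors m \<inter> small_primes (Z j) = {}"
            using prime_factors_prime_part[of m "- small_primes (Z j)"] by (auto simp: ro_def)
          then show "prime_factors a \<subseteq> small_primes (Z i) - small_primes (Z j)"
            using m \<open>m > 0\<close> by (auto simp: prime_factors_prime_part)
        qed
        also have "Z i / Z j = 2" using Suc J2[OF i] by (simp add: ZSuc)
        finally show "(\<Sum>a\<in>A. 1 / real a) \<le> 2 * exp 10" by simp
      qed (auto simp: M_def)
      also have "\<dots> \<le> (2 * exp 10) * (56 * exp 10 * L)"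
        by (intro mult_left_mono window i) auto
      also have "\<dots> = W" by (simp add: W_def c_def e20)
      finally show ?thesis .
    qed
    have RW: "(\<Sum>m\<in>R. 1 / real m) \<le> W"
    proof -
      \<comment> \<open>Members of \<open>R\<close> fail at scale \<open>J\<close> too, so the
        window applies there; as \<open>Z J\<close> < 4, all possible smooth parts together
        contribute at most 4 e^9.\<close>
      have "(\<Sum>m\<in>R. 1 / real m) \<le> (4 * exp 9) * (2 * exp 10 * ((E J + 6) / Z J))"
      proof (rule sum_inverse_window_smooth_le)
        show "2 \<le> Z J" "Z J \<le> Y" "0 \<le> E J" "E J \<le> Y / 2" using J2[of J] ZY E0[of J] by auto
        show "ln (real n) \<le> Y \<and> Y < ln (real (prime_part (- small_primes (Z J)) n)) + E J" if "n \<in> R" for n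
          using that lnN[of n] by (auto simp: R_def good_def ro_def not_le)
        fix A assume A: "A = prime_part (small_primes (Z J)) ` R"
        have "(\<Sum>a\<in>A. 1 / real a) = (\<Sum>a\<in>A. 1 ^ omega a * real a powr (-1))"
          by (simp add: powr_minus inverse_eq_divide)
        also have "\<dots> \<le> (\<Prod>p\<in>small_primes (Z J). 1 + 1 / (real p powr 1 - 1))"
        proof (rule sum_smooth_le)
          show "0 \<notin> A" unfolding A by (metis imageE less_irrefl prime_part_pos)
          show "finite A" unfolding A by (simp add: R_def)
          show "prime_factors n \<subseteq> small_primes (Z J)" if "n \<in> A" for n
            using that unfolding A by (auto simp: prime_factors_prime_part R_def)
        qed (auto simp: prime_small_primes)
        also have "\<dots> \<le> exp (1 * ((\<Sum>p\<in>small_primes (Z J). 1 / real p) + 1))"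
          using prod_one_plus_le[of "small_primes (Z J)" 1] by (simp add: prime_ge_2_nat prime_small_primes)
        also have "\<dots> \<le> exp (ln (Z J) + 9)"
          using sum_inverse_small_primes_le[of "Z J"] J2[of J] by simp
        also have "\<dots> = Z J * exp 9" using J2[of J] by (simp add: exp_add)
        also have "\<dots> \<le> 4 * exp 9" using J1 by (simp add: ZSuc)
        finally show "(\<Sum>a\<in>A. 1 / real a) \<le> 4 * exp 9" .
      qed (auto simp: R_def)
      also have "\<dots> \<le> (4 * exp 9) * (56 * exp 10 * L)"
        by (intro mult_left_mono window) auto
      also have "\<dots> \<le> W"
      proof -
        have "2 * exp 9 \<le> exp 1 * exp (9::real)"
          using exp_ge_add_one_self[of "1::real"] by (intro mult_right_mono) auto
        also have "\<dots> = exp 10" by (simp flip: exp_add)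
        finally have "2 * exp (9::real) * (112 * exp 10 * L) \<le> exp 10 * (112 * exp 10 * L)"
          using L by (intro mult_right_mono) auto
        then show ?thesis by (simp add: W_def c_def e20)
      qed
      finally show ?thesis .
    qed
    have piece_bdd: "mean_bdd (\<lambda>t. cmod (piece (S j) t) powr q) (K * W powr (q / 2) * Z j powr \<beta>)" if "j \<le> J" for j
      unfolding fib[symmetric]
    proof (rule K(2))
      show "2 \<le> Z j" using J2[OF that] .
      have "Z j ^ 25 \<le> Y ^ 25" using J2[OF that] ZY by (intro power_mono) auto
      also have "Y ^ 25 = exp (25 * L)"
      proof -
        have "Y > 0" using L Y by linarith
        then have "Y ^ 25 = exp L ^ 25" by (simp add: L_def)
        also have "\<dots> = exp (real 25 * L)" by (rule exp_of_nat_mult[symmetric])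
        finally show ?thesis by simp
      qed
      finally have "exp (- (25 * L)) * Z j ^ 25 \<le> exp (- (25 * L)) * exp (25 * L)"
        by (intro mult_left_mono) auto
      also have "\<dots> = 1" by (simp flip: exp_add)
      finally show "exp (- E j / Z j) * Z j ^ 25 \<le> 1" using EZ[of j] by simp
      show "\<forall>m\<in>M j. ln (real m) + E j \<le> ln (real N)"
        by (auto simp: M_def good_def Y_def)
    qed (use N W MW[OF that] in \<open>auto simp: M_def\<close>)
    have R_bdd: "mean_bdd (\<lambda>t. cmod (piece R t) powr q) (W powr (q / 2))"
    proof -
      have "piece R = dpoly R (\<lambda>n. real n powr (-1/2))" by (auto simp: piece_def dpoly_def)
      then have "has_mean (\<lambda>t. (cmod (piece R t))\<^sup>2) (\<Sum>n\<in>R. (real n powr (-1/2))\<^sup>2)"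
        by (simp add: has_mean_dpoly R_def)
      moreover have "(\<Sum>n\<in>R. (real n powr (-1/2))\<^sup>2) = (\<Sum>n\<in>R. 1 / real n)"
        by (intro sum.cong) (auto simp: R_def powr_power powr_minus field_simps)
      ultimately have X: "mean_bdd (\<lambda>t. (cmod (piece R t))\<^sup>2) W"
        using RW by (auto intro: has_mean_imp_mean_bdd)
      \<comment> \<open>On \<open>R\<close> Hoelder against the constant 1 is enough: the mean
        square is at most \<open>W\<close>, with no power of \<open>Z\<close> to save.\<close>
      have "mean_bdd (\<lambda>t. cmod (piece R t) powr q) (W powr (q / 2) * 1 powr (1 - q / 2))"
      proof (rule mean_bdd_Hoelder[OF X])
        show "mean_bdd (\<lambda>_. 1) 1" by (rule mean_bdd_const) simp
        show "cmod (piece R t) powr q \<le> ((cmod (piece R t))\<^sup>2) powr (q / 2) * 1 powr (1 - q / 2)" for t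
          using powr_powr[of "cmod (piece R t)" 2 "q / 2"] by simp
      qed (use q W in auto)
      then show ?thesis by simp
    qed
    have split: "piece {1..N} t = (\<Sum>j\<le>J. piece (S j) t) + piece R t" for t
    proof -
      have U: "{1..N} = (\<Union>j\<in>{..J}. S j) \<union> R"
      proof (intro equalityI subsetI)
        fix n assume n: "n \<in> {1..N}"
        show "n \<in> (\<Union>j\<in>{..J}. S j) \<union> R"
        proof (cases "\<exists>j\<le>J. good j n")
          case True
          define j where "j = (LEAST j. good j n)"
          obtain k where k: "k \<le> J" "good k n" using True by blast
          have "good j n" unfolding j_def using k(2) by (rule LeastI)
          moreover have "j \<le> J" unfolding j_def using Least_le[of "\<lambda>j. good j n", OF k(2)] k(1) by linarith
          moreover have "\<not> good i n" if "i < j" for i using not_less_Least that unfolding j_def by blast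
          ultimately show ?thesis using n by (auto simp: S_def)
        next
          case False
          then show ?thesis using n by (auto simp: R_def)
        qed
      qed (auto simp: S_def R_def)
      have dj: "S i \<inter> S j = {}" if "i \<noteq> j" for i j
        using that unfolding S_def by (cases i j rule: linorder_cases) auto
      have dR: "(\<Union>j\<in>{..J}. S j) \<inter> R = {}" by (auto simp: S_def R_def)
      have fin: "finite (S j)" "finite R" for j by (auto simp: S_def R_def)
      let ?g = "\<lambda>n. of_real (real n powr (-1/2)) * chi n t :: complex"
      have "piece {1..N} t = sum ?g (\<Union>j\<in>{..J}. S j) + sum ?g R"
        unfolding piece_def U using fin dR by (intro sum.union_disjoint) auto
      also have "sum ?g (\<Union>j\<in>{..J}. S j) = (\<Sum>j\<le>J. sum ?g (S j))"
        using fin dj by (intro sum.UNION_disjoint) auto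
      finally show ?thesis by (simp add: piece_def)
    qed
    have "mean_bdd (\<lambda>t. (\<Sum>j\<le>J. cmod (piece (S j) t) powr q) + cmod (piece R t) powr q)
        ((\<Sum>j\<le>J. K * W powr (q / 2) * Z j powr \<beta>) + W powr (q / 2))"
      by (intro mean_bdd_add mean_bdd_sum R_bdd piece_bdd) auto
    then show ?thesis
    proof (rule mean_bdd_mono)
      fix t
      have "cmod (piece {1..N} t) powr q \<le> (cmod (\<Sum>j\<le>J. piece (S j) t) + cmod (piece R t)) powr q"
        unfolding split using q by (intro powr_mono2 norm_triangle_ineq) auto
      also have "\<dots> \<le> cmod (\<Sum>j\<le>J. piece (S j) t) powr q + cmod (piece R t) powr q"
        using q by (intro powr_add_le) auto
      also have "cmod (\<Sum>j\<le>J. piece (S j) t) powr q \<le> (\<Sum>j\<le>J. cmod (piece (S j) t) powr q)"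
        using q by (intro powr_norm_sum_le) auto
      finally show "cmod (piece {1..N} t) powr q \<le> (\<Sum>j\<le>J. cmod (piece (S j) t) powr q) + cmod (piece R t) powr q"
        by simp
    next
      \<comment> \<open>Since \<open>Z j\<close> halves at each step, the bounds form a geometric
        series with ratio x = 2^(-\<beta>), and no factor counting the scales is lost.\<close>
      have Zb: "Z j powr \<beta> = Z 0 powr \<beta> * x ^ j" for j
      proof -
        have "((1/2) ^ j) powr \<beta> = x ^ j"
          by (simp add: x_def powr_power powr_realpow[symmetric] powr_powr mult.commute)
        then show ?thesis using Z0 by (subst Zpow) (simp add: powr_mult)
      qed
      have "(\<Sum>j\<le>J. Z j powr \<beta>) = Z 0 powr \<beta> * (\<Sum>j\<le>J. x ^ j)"
        by (subst sum_distrib_left) (intro sum.cong refl Zb)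
      also have "(\<Sum>j\<le>J. x ^ j) = (1 - x ^ Suc J) / (1 - x)" using x by (simp add: sum_gp0)
      also have "Z 0 powr \<beta> * ((1 - x ^ Suc J) / (1 - x)) \<le> Z 0 powr \<beta> * (1 / (1 - x))"
        using x by (intro mult_left_mono divide_right_mono) auto
      finally have "(\<Sum>j\<le>J. Z j powr \<beta>) \<le> Z 0 powr \<beta> / (1 - x)" by simp
      then have "K * W powr (q / 2) * (\<Sum>j\<le>J. Z j powr \<beta>) \<le> K * W powr (q / 2) * (Z 0 powr \<beta> / (1 - x))"
        using K by (intro mult_left_mono) auto
      \<comment> \<open>\<open>Z 0 \<ge> 1\<close> lets the leading term absorb the contribution of
        \<open>R\<close>.\<close>
      moreover have "W powr (q / 2) * 1 \<le> W powr (q / 2) * Z 0 powr \<beta>"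
        using Z0 beta by (intro mult_left_mono ge_one_powr_ge_zero) auto
      ultimately have "(\<Sum>j\<le>J. K * W powr (q / 2) * Z j powr \<beta>) + W powr (q / 2) \<le>
          K * W powr (q / 2) * (Z 0 powr \<beta> / (1 - x)) + W powr (q / 2) * Z 0 powr \<beta>"
        by (simp add: sum_distrib_left)
      also have "\<dots> = ((K / (1 - x) + 1) * W powr (q / 2)) * Z 0 powr \<beta>"
        by (simp add: algebra_simps)
      also have "\<dots> = (K' * L powr (q / 2)) * Z 0 powr \<beta>"
        using L by (simp add: K'_def W_def c_def powr_mult)
      also have "\<dots> \<le> (K' * L powr (q / 2)) * (Y / L) powr \<beta>"
      proof (intro mult_left_mono powr_mono2)
        show "0 \<le> K' * L powr (q / 2)" using K x by (simp add: K'_def)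
        have "Y / (50 * L) \<le> Y / L" using L Y by (intro divide_left_mono) auto
        then show "Z 0 \<le> Y / L" by (simp add: Z_def E_def mult_ac)
      qed (use beta Z0 in auto)
      finally show "(\<Sum>j\<le>J. K * W powr (q / 2) * Z j powr \<beta>) + W powr (q / 2) \<le>
          K' * ln (ln (real N)) powr (q / 2) * (ln (real N) / ln (ln (real N))) powr \<beta>"
        by (simp add: L_def Y_def)
    qed
  qed
  moreover have "K' > 0" using K x by (simp add: K'_def c_def add_pos_pos)
  ultimately show ?thesis unfolding \<beta>_def by blast
qed

lemma dirichlet_norm_zeta_half_poly_le:
  assumes q: "0 < q" "q \<le> 1"
  shows "\<exists>C>0. \<forall>\<^sub>F N in sequentially. dirichlet_norm q (zeta_half_poly N) \<le>
    C * ln (real N) powr norm_exponent q * ln (ln (real N)) powr (1 / 2 - norm_exponent q)"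
proof -
  let ?\<alpha> = "norm_exponent q"
  obtain K where K: "K > 0" "\<And>N. N > 0 \<Longrightarrow> ln (ln (real N)) \<ge> 1 \<Longrightarrow> ln (real N) / (50 * ln (ln (real N))) \<ge> 2 \<Longrightarrow>
     mean_bdd (\<lambda>t. cmod (piece {1..N} t) powr q)
       (K * ln (ln (real N)) powr (q / 2) * (ln (real N) / ln (ln (real N))) powr (q * ?\<alpha>))"
    using mean_bdd_zeta_half_poly[OF q] by blast
  have "\<forall>\<^sub>F N::nat in sequentially. ln (ln (real N)) \<ge> 1" by real_asymp
  moreover have "\<forall>\<^sub>F N::nat in sequentially. ln (real N) / (50 * ln (ln (real N))) \<ge> 2" by real_asymp
  ultimately have "\<forall>\<^sub>F N in sequentially. dirichlet_norm q (zeta_half_poly N) \<le>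
    K powr (1 / q) * ln (real N) powr ?\<alpha> * ln (ln (real N)) powr (1 / 2 - ?\<alpha>)"
    using eventually_gt_at_top[of 0]
  proof eventually_elim
    case (elim N)
    define Y L where "Y = ln (real N)" and "L = ln Y"
    have L: "L \<ge> 1" using elim by (simp add: L_def Y_def)
    have "Y / (50 * L) \<ge> 2" using elim by (simp add: Y_def L_def)
    then have "Y \<ge> 100 * L" using L by (simp add: field_simps)
    then have Y: "Y > 0" using L by linarith
    have "dirichlet_norm q (zeta_half_poly N) \<le> (K * L powr (q / 2) * (Y / L) powr (q * ?\<alpha>)) powr (1 / q)"
      using dirichlet_norm_le[OF q(1) K(2)] elim by (simp add: L_def Y_def)
    also have "\<dots> = K powr (1 / q) * L powr (1 / 2) * (Y / L) powr ?\<alpha>"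
      using q K L Y by (simp add: powr_mult powr_powr)
    also have "\<dots> = K powr (1 / q) * Y powr ?\<alpha> * L powr (1 / 2 - ?\<alpha>)"
      using L Y by (simp add: powr_divide powr_diff)
    finally show ?case by (simp add: L_def Y_def)
  qed
  moreover have "K powr (1 / q) > 0" using K by simp
  ultimately show ?thesis by blast
qed

theorem theorem1:
  shows "(\<forall>q::real. 0 < q \<and> q \<le> 1 \<longrightarrow>
           (\<exists>C>0. \<exists>e::nat \<Rightarrow> real. e \<in> o(\<lambda>_. 1) \<and>
             (\<forall>\<^sub>F N in sequentially.
                dirichlet_norm q (zeta_half_poly N)
                  \<le> (1 + e N) * C * ln (real N) powr norm_exponent q
                      * ln (ln (real N)) powr (1 / 2 - norm_exponent q))))
         \<and> (\<lambda>N. dirichlet_norm 1 (zeta_half_poly N))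
              \<in> O(\<lambda>N. ln (real N) powr (1 / 4) * ln (ln (real N)) powr (1 / 4))"
proof (intro conjI allI impI)
  fix q :: real assume "0 < q \<and> q \<le> 1"
  then obtain C where C: "C > 0" "\<forall>\<^sub>F N in sequentially. dirichlet_norm q (zeta_half_poly N) \<le>
    C * ln (real N) powr norm_exponent q * ln (ln (real N)) powr (1 / 2 - norm_exponent q)"
    using dirichlet_norm_zeta_half_poly_le by blast
  show "\<exists>C>0. \<exists>e::nat \<Rightarrow> real. e \<in> o(\<lambda>_. 1) \<and>
             (\<forall>\<^sub>F N in sequentially.
                dirichlet_norm q (zeta_half_poly N)
                  \<le> (1 + e N) * C * ln (real N) powr norm_exponent q
                      * ln (ln (real N)) powr (1 / 2 - norm_exponent q))"
    \<comment> \<open>The estimate holds for all large N with a fixed constant, so the o(1) is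
      realised by zero.\<close>
    using C by (intro exI[of _ C] conjI exI[of _ "\<lambda>_. 0"]) auto
next
  obtain C where C: "\<forall>\<^sub>F N in sequentially. dirichlet_norm 1 (zeta_half_poly N) \<le>
    C * ln (real N) powr norm_exponent 1 * ln (ln (real N)) powr (1 / 2 - norm_exponent 1)"
    using dirichlet_norm_zeta_half_poly_le[of 1] by auto
  show "(\<lambda>N. dirichlet_norm 1 (zeta_half_poly N))
              \<in> O(\<lambda>N. ln (real N) powr (1 / 4) * ln (ln (real N)) powr (1 / 4))"
  proof (rule bigoI[where c = C])
    show "\<forall>\<^sub>F N in sequentially. norm (dirichlet_norm 1 (zeta_half_poly N)) \<le>
      C * norm (ln (real N) powr (1 / 4) * ln (ln (real N)) powr (1 / 4))"
      using C
    proof eventually_elim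
      case (elim N)
      have "dirichlet_norm 1 (zeta_half_poly N) \<ge> 0" by (simp add: dirichlet_norm_def)
      then show ?case using elim by (simp add: norm_exponent_def mult.assoc)
    qed
  qed
qed

end
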